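(* Let $W$ and $D$ satisfy the standing assumptions in the context. Let $T$ be the operator $$T\rho(u,x)=-\frac{\beta}{2\pi}\int_0^1\!\!\int_0^{2\pi}W(x,y)D(u-v)\rho(v,y)\,dv\,dy,$$ restricted to functions even in $u$, i.e. satisfying $\rho(-u,x)=\rho(u,x)$. Suppose $\theta_0^{-1}$ is a simple eigenvalue of $T$. Then $(\rho,\theta)=\left(\frac1{2\pi},\theta_0\right)$ is a bifurcation point of $g=0$, where $g(\rho,\theta):=\rho-f(\rho,\theta)$ and $f$ is defined in the context.
   Context: Standing assumptions: $W:[0,1]^2\to[0,1]$ is symmetric and measurable and satisfies $\int_0^1|W(x_1,y)-W(x_2,y)|\,dy\to0$ as $|x_1-x_2|\to0$; $D:[0,2\pi]\to\mathbb{R}$ is a Lipschitz continuous, even, $2\pi$-periodic function; $\beta$ is the inverse temperature and $\theta$ the interaction strength. The map $f:L^1([0,2\pi]\times[0,1])\to L^1([0,2\pi]\times[0,1])$ is $$f(\rho,\theta)(u,x)=\frac1{Z}\exp\Big(-\beta\theta\int_0^1\!\!\int_0^{2\pi}W(x,y)D(u-v)\rho(v,y)\,dv\,dy\Big),$$ where $Z$ is the normalisation (over $u$, for each $x$). Probability densities $\rho(u,x)$, $u\in[0,2\pi]$ (periodic), $x\in[0,1]$, solving $g(\rho,\theta)=0$ are the stationary states of the McKean-Vlasov equation $$\partial_t\rho=\theta\,\partial_u\Big(\rho\int_0^1\!\!\int_0^{2\pi}W(x,y)D'(u-v)\rho(t,v,y)\,dv\,dy\Big)+\beta^{-1}\partial_u^2\rho.$$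 The uniform state $\rho\equiv\frac1{2\pi}$ is a solution for every $\theta$. The analysis of $T$ is restricted to the subspace of even probability densities, i.e. functions with $\rho(-u,x)=\rho(u,x)$.
   Formalization: T is restricted to even functions whose integral over u vanishes for almost every x, not to all even functions; on all even functions the claim fails (W=1, D=-1: β is a simple eigenvalue of T, but f is identically 1/(2π), so there is no bifurcation). *)

theory Defs
  imports "HOL-Analysis.Analysis"
begin

text \<open>
  Elements of \<open>L\<^sup>1([0,2\<pi>] \<times> [0,1])\<close> are represented by functions on \<^typ>\<open>real \<times> real\<close>, integrable over
  the cylinder below; equality in \<open>L\<^sup>1\<close> is equality almost everywhere on it.
\<close>

abbreviation circle :: "real measure" where
  "circle \<equiv> lebesgue_on {0..2*pi}"

abbreviation unit_interval :: "real measure" where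
  "unit_interval \<equiv> lebesgue_on {0..1}"

abbreviation cylinder :: "(real \<times> real) measure" where
  "cylinder \<equiv> lebesgue_on ({0..2*pi} \<times> {0..1})"

definition interaction ::
  "(real \<Rightarrow> real \<Rightarrow> real) \<Rightarrow> (real \<Rightarrow> real) \<Rightarrow> (real \<times> real \<Rightarrow> real) \<Rightarrow> real \<times> real \<Rightarrow> real" where
  "interaction W D \<rho> = (\<lambda>(u, x).
     LINT y|unit_interval. LINT v|circle. W x y * D (u - v) * \<rho> (v, y))"

definition gibbs_map ::
  "real \<Rightarrow> (real \<Rightarrow> real \<Rightarrow> real) \<Rightarrow> (real \<Rightarrow> real) \<Rightarrow> (real \<times> real \<Rightarrow> real) \<Rightarrow> real \<Rightarrow> real \<times> real \<Rightarrow> real" where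
  "gibbs_map \<beta> W D \<rho> \<theta> = (\<lambda>(u, x).
     exp (- \<beta> * \<theta> * interaction W D \<rho> (u, x)) /
     (LINT u'|circle. exp (- \<beta> * \<theta> * interaction W D \<rho> (u', x))))"

definition stationarity_map ::
  "real \<Rightarrow> (real \<Rightarrow> real \<Rightarrow> real) \<Rightarrow> (real \<Rightarrow> real) \<Rightarrow> (real \<times> real \<Rightarrow> real) \<Rightarrow> real \<Rightarrow> real \<times> real \<Rightarrow> real" where
  "stationarity_map \<beta> W D \<rho> \<theta> = (\<lambda>p. \<rho> p - gibbs_map \<beta> W D \<rho> \<theta> p)"

definition T_operator ::
  "real \<Rightarrow> (real \<Rightarrow> real \<Rightarrow> real) \<Rightarrow> (real \<Rightarrow> real) \<Rightarrow> (real \<times> real \<Rightarrow> real) \<Rightarrow> real \<times> real \<Rightarrow> real" where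
  "T_operator \<beta> W D \<rho> = (\<lambda>p. - (\<beta> / (2*pi)) * interaction W D \<rho> p)"

text \<open>
  The variable \<open>u\<close> is an angle, so \<open>-u\<close> is represented in \<open>[0,2\<pi>]\<close> by \<open>2\<pi> - u\<close>.
\<close>

definition even_L1 :: "(real \<times> real \<Rightarrow> real) set" where
  "even_L1 = {\<rho>. integrable cylinder \<rho> \<and> (AE (u, x) in cylinder. \<rho> (2*pi - u, x) = \<rho> (u, x))}"

definition even_densities :: "(real \<times> real \<Rightarrow> real) set" where
  "even_densities = {\<rho> \<in> even_L1. (AE p in cylinder. 0 \<le> \<rho> p) \<and>
     (AE x in unit_interval. (LINT u|circle. \<rho> (u, x)) = 1)}"

text \<open>
  The directions tangent to the even densities. \<^const>\<open>T_operator\<close> has to be considered on this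
  space: \<^const>\<open>gibbs_map\<close> is unchanged when a constant is added to \<open>D\<close>, while the action of the
  operator on functions depending on \<open>x\<close> only is not, and eigenvalues with such
  eigenfunctions (take \<open>W = 1\<close> and \<open>D = -1\<close>) are unrelated to bifurcations. The space is
  invariant under the operator.
\<close>

definition even_tangent :: "(real \<times> real \<Rightarrow> real) set" where
  "even_tangent = {\<rho> \<in> even_L1. AE x in unit_interval. (LINT u|circle. \<rho> (u, x)) = 0}"

definition simple_eigenvalue_on ::
  "'a measure \<Rightarrow> ('a \<Rightarrow> real) set \<Rightarrow> (('a \<Rightarrow> real) \<Rightarrow> 'a \<Rightarrow> real) \<Rightarrow> real \<Rightarrow> bool" where
  "simple_eigenvalue_on M X A \<mu> \<longleftrightarrow>
     (\<exists>\<phi>\<in>X. \<not> (AE p in M. \<phi> p = 0) \<and> (AE p in M. A \<phi> p = \<mu> * \<phi> p) \<and>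
        (\<forall>\<psi>\<in>X. (AE p in M. A \<psi> p = \<mu> * \<psi> p) \<longrightarrow> (\<exists>c. AE p in M. \<psi> p = c * \<phi> p)))"

text \<open>
  Bifurcation from the branch of trivial solutions \<open>(\<rho>\<^sub>0, \<theta>)\<close>: every neighbourhood of
  \<open>(\<rho>\<^sub>0, \<theta>\<^sub>0)\<close> in \<open>X \<times> \<real>\<close>, where \<open>X\<close> carries the \<open>L\<^sup>1\<close> distance, contains a nontrivial solution.
\<close>

definition bifurcation_point ::
  "'a measure \<Rightarrow> ('a \<Rightarrow> real) set \<Rightarrow> (('a \<Rightarrow> real) \<Rightarrow> real \<Rightarrow> 'a \<Rightarrow> real) \<Rightarrow> ('a \<Rightarrow> real) \<Rightarrow> real \<Rightarrow> bool" where
  "bifurcation_point M X G \<rho>\<^sub>0 \<theta>\<^sub>0 \<longleftrightarrow>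
     \<rho>\<^sub>0 \<in> X \<and> (\<forall>\<theta>. AE p in M. G \<rho>\<^sub>0 \<theta> p = 0) \<and>
     (\<forall>\<epsilon>>0. \<exists>\<rho>\<in>X. \<exists>\<theta>.
        (LINT p|M. \<bar>\<rho> p - \<rho>\<^sub>0 p\<bar>) < \<epsilon> \<and> \<bar>\<theta> - \<theta>\<^sub>0\<bar> < \<epsilon> \<and>
        (AE p in M. G \<rho> \<theta> p = 0) \<and> \<not> (AE p in M. \<rho> p = \<rho>\<^sub>0 p))"

end

theory Submission
  imports Defs "HOL-Complex_Analysis.Great_Picard"
begin

text \<open>
  Subtracting its mean and symmetrising turns \<open>D\<close> into a kernel whose operator \<open>J\<close> ranges in the even
  functions of mean zero in \<open>u\<close> and differs from the interaction, on even functions of constant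
  \<open>u\<close>-mean, by a function of \<open>x\<close> only; such functions do not affect the normalised exponential. Hence
  \<open>\<rho> = e\<^sup>h / Z\<close> is stationary as soon as \<open>h = - \<beta> \<theta> J (e\<^sup>h / Z)\<close>, an equation
  \<open>\<kappa> h = T h + R h\<close> with \<open>\<kappa> = 1 / \<theta>\<close> for bounded continuous \<open>h\<close>, where \<open>T\<close> is compact and
  \<open>R\<close> has arbitrarily small Lipschitz constants near 0.

  If \<open>T \<phi> = \<kappa>\<^sub>0 \<phi>\<close> is a simple eigenvalue and \<open>l\<close> a functional with \<open>l \<circ> T = \<kappa>\<^sub>0 l\<close> and \<open>l \<phi> = 1\<close>
  (here the \<open>L\<^sup>2\<close> pairing with \<open>\<phi>\<close>, as the kernel is symmetric), then \<open>\<kappa>\<^sub>0 - T + \<phi> l\<close> is invertible by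
  the Fredholm alternative, and inserting \<open>h = s (\<phi> + w)\<close>, \<open>\<kappa> = \<kappa>\<^sub>0 + l (R h) / s\<close> gives a fixed-point
  equation for \<open>w\<close> that is a contraction of the unit ball for small \<open>s > 0\<close>.
\<close>

section \<open>Compact operators and the Fredholm alternative\<close>

text \<open>The unknown is the potential \<open>h\<close> rather than the density: the exponential
  then acts on bounded functions, where its second-order remainder is small in the same norm, and
  positivity and normalisation of the density hold by construction. Symmetrising the kernel replaces
  the restriction to even functions: a solution \<open>h\<close> lies in the range of
  \<open>J\<close> and is therefore even on the cylinder, so the abstract theorem can run on the
  full space of bounded continuous functions. Removing the mean does the same for the normalisation,
  whose first-order variation is a function of x alone and is annihilated. The value of \<kappa> is
  forced: apply l to \<kappa> h = T h + R h and use l h = s, that is l w = 0. Since R is only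
  controlled by Lipschitz constants, a contraction stands in for the implicit function theorem.
  Hypothesis and conclusion live in L^1, and the passage is by regularity: an integrable
  eigenfunction is almost everywhere a multiple of its image under \<open>J\<close>, hence bounded,
  hence continuous up to null sets.\<close>

definition compact_map :: "('a::real_normed_vector \<Rightarrow> 'b::real_normed_vector) \<Rightarrow> bool" where
  "compact_map K \<longleftrightarrow> (\<forall>x::nat \<Rightarrow> 'a. bounded (range x) \<longrightarrow>
     (\<exists>r y. strict_mono r \<and> (\<lambda>n. K (x (r n))) \<longlonglongrightarrow> y))"

lemma compact_mapD:
  assumes "compact_map K" "\<And>n. norm (x n) \<le> B"
  obtains r y where "strict_mono (r::nat \<Rightarrow> nat)" "(\<lambda>n. K (x (r n))) \<longlonglongrightarrow> y"
  using assms unfolding compact_map_def bounded_iff by blast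

text \<open>Take \<open>v\<close> in \<open>V\<close> at distance below \<open>2 * d\<close> from
  \<open>x\<close>, where \<open>d\<close> is the distance from \<open>x\<close> to
  \<open>V\<close>. After rescaling, subtracting an element of \<open>V\<close> from the normalised
  \<open>x - v\<close> gives another competitor for \<open>d\<close>. The slack factor 2 replaces an
  attained infimum and becomes the bound 1/2.\<close>

lemma Riesz_lemma:
  fixes V :: "'a::real_normed_vector set"
  assumes V: "subspace V" "closed V" and x: "x \<notin> V"
  shows "\<exists>v\<in>V. \<forall>z\<in>V. 1 / 2 \<le> norm ((x - v) /\<^sub>R norm (x - v) - z)"
proof -
  have "V \<noteq> {}" using V subspace_0 by blast
  define d where "d = infdist x V"
  have d: "d > 0"
    unfolding d_def using V x \<open>V \<noteq> {}\<close> in_closed_iff_infdist_zero infdist_nonneg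
    by (metis less_eq_real_def)
  obtain v where v: "v \<in> V" "dist x v < 2 * d"
    using infdist_attains_inf d d_def by (metis \<open>V \<noteq> {}\<close> cINF_less_iff bdd_below_image_dist
      field_sum_of_halves infdist_notempty less_add_same_cancel1 mult_2)
  have nv: "norm (x - v) > 0" using v x by auto
  have "1 / 2 \<le> norm ((x - v) /\<^sub>R norm (x - v) - z)" if z: "z \<in> V" for z
  proof -
    have "v + norm (x - v) *\<^sub>R z \<in> V"
      using V v z by (simp add: subspace_add subspace_scale)
    then have "d \<le> norm (x - (v + norm (x - v) *\<^sub>R z))"
      unfolding d_def using infdist_le by (metis dist_norm)
    also have "x - (v + norm (x - v) *\<^sub>R z) = norm (x - v) *\<^sub>R ((x - v) /\<^sub>R norm (x - v) - z)"
      using nv by (simp add: scaleR_diff_right)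
    finally have "d \<le> norm (x - v) * norm ((x - v) /\<^sub>R norm (x - v) - z)"
      by simp
    moreover have "norm (x - v) < 2 * d" using v by (simp add: dist_norm)
    ultimately have "norm (x - v) * (1 / 2) \<le> norm (x - v) * norm ((x - v) /\<^sub>R norm (x - v) - z)"
      by linarith
    then show ?thesis using nv by (simp only: mult_le_cancel_left_pos)
  qed
  then show ?thesis using v by blast
qed

text \<open>If no \<open>m\<close> works, there are unit vectors y with c y - K y -> 0. Compactness
  makes a subsequence of K y converge, and division by \<open>c\<close> makes y itself converge, to
  a unit vector in the kernel.\<close>

lemma bounded_below_compact_perturbation:
  fixes K :: "'a::real_normed_vector \<Rightarrow> 'a"
  assumes K: "bounded_linear K" "compact_map K" and c: "c \<noteq> 0"
    and inj: "\<And>x. c *\<^sub>R x - K x = 0 \<Longrightarrow> x = 0"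
  obtains m where "m > 0" "\<And>x. m * norm x \<le> norm (c *\<^sub>R x - K x)"
proof (rule ccontr)
  interpret K: bounded_linear K by fact
  assume "\<not> thesis"
  then have "\<exists>x. norm (c *\<^sub>R x - K x) < inverse (Suc n) * norm x" for n
    using that[of "inverse (Suc n)"] by (metis not_le inverse_positive_iff_positive of_nat_0_less_iff zero_less_Suc)
  then obtain x where x: "\<And>n. norm (c *\<^sub>R x n - K (x n)) < inverse (Suc n) * norm (x n)"
    by metis
  define y where "y n = x n /\<^sub>R norm (x n)" for n
  have xn: "x n \<noteq> 0" for n using x[of n] by auto
  have ny: "norm (y n) = 1" for n using xn by (simp add: y_def)
  have "norm (c *\<^sub>R y n - K (y n)) = norm (c *\<^sub>R x n - K (x n)) / norm (x n)" for n
  proof -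
    have "c *\<^sub>R y n - K (y n) = (c *\<^sub>R x n - K (x n)) /\<^sub>R norm (x n)"
      by (simp add: y_def K.scaleR scaleR_diff_right mult.commute)
    then show ?thesis by (simp add: divide_inverse mult.commute)
  qed
  then have small: "norm (c *\<^sub>R y n - K (y n)) \<le> inverse (Suc n)" for n
    using x[of n] xn[of n] by (simp add: pos_divide_le_eq)
  have lim0: "(\<lambda>n. c *\<^sub>R y n - K (y n)) \<longlonglongrightarrow> 0"
    by (rule Lim_null_comparison[OF _ LIMSEQ_inverse_real_of_nat]) (use small in auto)
  obtain r z where r: "strict_mono (r::nat \<Rightarrow> nat)" and z: "(\<lambda>n. K (y (r n))) \<longlonglongrightarrow> z"
    using compact_mapD[OF K(2), of y 1] ny by auto
  have "(\<lambda>n. c *\<^sub>R y (r n) - K (y (r n))) \<longlonglongrightarrow> 0"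
    using LIMSEQ_subseq_LIMSEQ[OF lim0 r] by (simp add: o_def)
  from tendsto_add[OF this z] have cy: "(\<lambda>n. c *\<^sub>R y (r n)) \<longlonglongrightarrow> z" by simp
  from tendsto_scaleR[OF tendsto_const[of "inverse c"] this]
  have yr: "(\<lambda>n. y (r n)) \<longlonglongrightarrow> z /\<^sub>R c" using c by simp
  have "(\<lambda>n. K (y (r n))) \<longlonglongrightarrow> K (z /\<^sub>R c)" by (rule K.tendsto[OF yr])
  then have "K (z /\<^sub>R c) = z" using z LIMSEQ_unique by blast
  then have "z /\<^sub>R c = 0" using inj[of "z /\<^sub>R c"] c by simp
  moreover have "(\<lambda>n. norm (y (r n))) \<longlonglongrightarrow> norm (z /\<^sub>R c)" by (rule tendsto_norm[OF yr])
  then have "norm (z /\<^sub>R c) = 1" using ny by (simp add: LIMSEQ_const_iff)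
  ultimately show False by (metis norm_zero zero_neq_one)
qed

text \<open>The lower bound turns a convergent sequence of images into a Cauchy sequence of
  preimages.\<close>

lemma closed_image_bounded_below:
  fixes A :: "'a::banach \<Rightarrow> 'b::real_normed_vector"
  assumes A: "bounded_linear A" and m: "m > 0" "\<And>x. m * norm x \<le> norm (A x)" and V: "closed V"
  shows "closed (A ` V)"
proof -
  interpret A: bounded_linear A by fact
  have "l \<in> A ` V" if y: "\<forall>n. y n \<in> A ` V" and l: "y \<longlonglongrightarrow> l" for y l
  proof -
  from y have "\<forall>n. \<exists>u. u \<in> V \<and> y n = A u" by blast
  then obtain x where x: "\<And>n. x n \<in> V" "\<And>n. y n = A (x n)" by metis
  have "Cauchy x"
  proof (rule CauchyI)
    fix e :: real assume "e > 0"
    then obtain N where N: "\<And>i j. i \<ge> N \<Longrightarrow> j \<ge> N \<Longrightarrow> norm (y i - y j) < m * e"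
      using CauchyD[OF LIMSEQ_imp_Cauchy[OF l], of "m * e"] m by auto
    have "norm (x i - x j) < e" if "i \<ge> N" "j \<ge> N" for i j
    proof -
      have "m * norm (x i - x j) \<le> norm (y i - y j)" using m(2)[of "x i - x j"] by (simp add: x A.diff)
      also have "\<dots> < m * e" using N that by blast
      finally show ?thesis using m(1) by simp
    qed
    then show "\<exists>M. \<forall>i\<ge>M. \<forall>j\<ge>M. norm (x i - x j) < e" by blast
  qed
  then obtain z where z: "x \<longlonglongrightarrow> z" by (auto simp: Cauchy_convergent_iff convergent_def)
  then have "z \<in> V" using V x closed_sequential_limits by blast
  moreover have "y \<longlonglongrightarrow> A z" using A.tendsto[OF z] x by presburger
  then have "A z = l" using l LIMSEQ_unique by blast
  ultimately show "l \<in> A ` V" by blast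
  qed
  then show ?thesis unfolding closed_sequential_limits by blast
qed

text \<open>Injectivity gives a lower bound, so an inverse is automatically bounded and surjectivity
  is what remains. If it failed, the ranges of the powers of \<open>A\<close> would form a strictly
  decreasing chain of closed subspaces, and unit vectors chosen along it by
  \<open>Riesz_lemma\<close> would have images under \<open>K\<close> without a convergent
  subsequence.\<close>

theorem Fredholm_alternative:
  fixes K :: "'a::banach \<Rightarrow> 'a"
  assumes K: "bounded_linear K" "compact_map K" and c: "c \<noteq> 0"
    and inj: "\<And>x. c *\<^sub>R x - K x = 0 \<Longrightarrow> x = 0"
  obtains S where "bounded_linear S" "\<And>y. c *\<^sub>R S y - K (S y) = y"
proof -
  interpret K: bounded_linear K by fact
  define A where "A x = c *\<^sub>R x - K x" for x
  have A: "bounded_linear A"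
    unfolding A_def by (intro bounded_linear_sub bounded_linear_scaleR_right K(1))
  interpret A: bounded_linear A by fact
  obtain m where m: "m > 0" "\<And>x. m * norm x \<le> norm (A x)"
    using bounded_below_compact_perturbation[OF K c inj] unfolding A_def by metis
  have injA: "x = y" if "A x = A y" for x y
    using inj[of "x - y"] that by (simp add: A_def K.diff algebra_simps)
  have surj: "\<exists>x. A x = y" for y
  proof (rule ccontr)
    assume y: "\<nexists>x. A x = y"
    define V where "V n = (A ^^ n) ` UNIV" for n
    have V_Suc: "V (Suc n) = A ` V n" for n by (simp add: V_def image_comp)
    have V_sub: "subspace (V n)" for n
    proof (induction n)
      case 0 show ?case by (simp add: V_def)
    next
      case (Suc n)
      show ?case unfolding V_Suc
        using Suc A.linear_axioms by (rule linear_subspace_image[rotated])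
    qed
    have V_closed: "closed (V n)" for n
    proof (induction n)
      case 0 show ?case by (simp add: V_def)
    next
      case (Suc n)
      show ?case unfolding V_Suc by (rule closed_image_bounded_below[OF A m Suc])
    qed
    have dec: "V (Suc n) \<subseteq> V n" for n
      by (induction n) (auto simp: V_Suc, simp add: V_def)
    have mono: "V j \<subseteq> V i" if "i \<le> j" for i j
      using lift_Suc_antimono_le[of V, OF dec that] .
    \<comment> \<open>Injectivity carries the missing vector down the chain, so every inclusion is
      strict.\<close>
    have yn: "(A ^^ n) y \<in> V n - V (Suc n)" for n
    proof (induction n)
      case 0 show ?case using y by (auto simp: V_def)
    next
      case (Suc n) then show ?case by (auto simp: V_Suc[of n] V_Suc[of "Suc n"] dest: injA)
    qed
    have "\<exists>u. u \<in> V n \<and> norm u = 1 \<and> (\<forall>z\<in>V (Suc n). 1 / 2 \<le> norm (u - z))" for n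
    proof -
      let ?x = "(A ^^ n) y"
      obtain v where v: "v \<in> V (Suc n)"
        "\<And>z. z \<in> V (Suc n) \<Longrightarrow> 1 / 2 \<le> norm ((?x - v) /\<^sub>R norm (?x - v) - z)"
        using Riesz_lemma[OF V_sub V_closed, of ?x "Suc n"] yn[of n] by blast
      moreover have "v \<in> V n" using v(1) dec by blast
      then have "?x - v \<in> V n" using yn[of n] V_sub by (simp add: subspace_diff)
      then have "(?x - v) /\<^sub>R norm (?x - v) \<in> V n" using V_sub subspace_scale by blast
      moreover have "?x - v \<noteq> 0" using yn[of n] v by auto
      then have "norm ((?x - v) /\<^sub>R norm (?x - v)) = 1" by simp
      ultimately show ?thesis by blast
    qed
    then obtain u where u: "\<And>n. u n \<in> V n" "\<And>n. norm (u n) = 1"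
      "\<And>n z. z \<in> V (Suc n) \<Longrightarrow> 1 / 2 \<le> norm (u n - z)" by metis
    have sep: "\<bar>c\<bar> / 2 \<le> norm (K (u i) - K (u j))" if "i < j" for i j
    proof -
      have uj: "u j \<in> V (Suc i)" using u(1) mono[of "Suc i" j] that by auto
      have "A (u i) \<in> V (Suc i)" "A (u j) \<in> V (Suc i)"
        using u(1)[of i] uj dec by (auto simp: V_Suc)
      \<comment> \<open>Chosen so that K (u i) - K (u j) is \<open>c\<close> times the difference of
        \<open>u i\<close> and this vector. It lies one level below \<open>u i\<close>, hence at
        distance at least 1/2.\<close>
      then have z: "(A (u i) + c *\<^sub>R u j - A (u j)) /\<^sub>R c \<in> V (Suc i)"
        using uj V_sub by (intro subspace_scale subspace_add subspace_diff) auto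
      have "K (u i) - K (u j) = c *\<^sub>R (u i - (A (u i) + c *\<^sub>R u j - A (u j)) /\<^sub>R c)"
        using c by (simp add: A_def algebra_simps)
      then have "norm (K (u i) - K (u j)) = \<bar>c\<bar> * norm (u i - (A (u i) + c *\<^sub>R u j - A (u j)) /\<^sub>R c)"
        by (metis norm_scaleR)
      then show ?thesis using mult_left_mono[OF u(3)[OF z], of "\<bar>c\<bar>"] by simp
    qed
    obtain r l where r: "strict_mono (r::nat \<Rightarrow> nat)" and l: "(\<lambda>n. K (u (r n))) \<longlonglongrightarrow> l"
      using compact_mapD[OF K(2), of u 1] u(2) by auto
    obtain N where "\<And>i j. i \<ge> N \<Longrightarrow> j \<ge> N \<Longrightarrow> norm (K (u (r i)) - K (u (r j))) < \<bar>c\<bar> / 2"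
      using CauchyD[OF LIMSEQ_imp_Cauchy[OF l], of "\<bar>c\<bar> / 2"] c by auto
    from this[of N "Suc N"] sep[of "r N" "r (Suc N)"] r show False
      by (simp add: strict_mono_Suc_iff)
  qed
  define S where "S y = (SOME x. A x = y)" for y
  have AS: "A (S y) = y" for y unfolding S_def using someI_ex[OF surj] .
  have "bounded_linear S"
  proof (rule bounded_linear_intro)
    show "S (x + y) = S x + S y" for x y by (rule injA) (simp add: AS A.add)
    show "S (a *\<^sub>R x) = a *\<^sub>R S x" for a x by (rule injA) (simp add: AS A.scaleR)
    show "norm (S x) \<le> norm x * inverse m" for x
      using m(2)[of "S x"] m(1) by (simp add: AS field_simps)
  qed
  then show thesis using that AS unfolding A_def by blast
qed

section \<open>Bifurcation from a simple eigenvalue\<close>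

text \<open>Lyapunov-Schmidt reduction by contraction. With K = T - \<phi> l, Q removing the
  \<phi>-component and P w = R h / s, the equation for w reads (\<open>\<kappa>\<^sub>0\<close> - K)
  w = Q (P w) - \<mu> w with \<mu> = l (P w). The rank-one term is harmless because l w = 0 at the
  fixed point.\<close>

theorem bifurcation_from_simple_eigenvalue:
  fixes T R :: "'a::banach \<Rightarrow> 'a" and l :: "'a \<Rightarrow> real"
  assumes T: "bounded_linear T" "compact_map T" and \<kappa>\<^sub>0: "\<kappa>\<^sub>0 \<noteq> 0"
    and \<phi>: "T \<phi> = \<kappa>\<^sub>0 *\<^sub>R \<phi>"
    and simple: "\<And>x. T x = \<kappa>\<^sub>0 *\<^sub>R x \<Longrightarrow> \<exists>c. x = c *\<^sub>R \<phi>"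
    and l: "bounded_linear l" "\<And>x. l (T x) = \<kappa>\<^sub>0 * l x" "l \<phi> = 1"
    and R0: "R 0 = 0"
    and R: "\<And>\<eta>. \<eta> > 0 \<Longrightarrow>
      \<exists>r>0. \<forall>x y. norm x \<le> r \<longrightarrow> norm y \<le> r \<longrightarrow> norm (R x - R y) \<le> \<eta> * norm (x - y)"
    and \<epsilon>: "\<epsilon> > 0"
  obtains x \<kappa> where "x \<noteq> 0" "norm x < \<epsilon>" "\<bar>\<kappa> - \<kappa>\<^sub>0\<bar> < \<epsilon>" "\<kappa> *\<^sub>R x = T x + R x"
proof -
  interpret T: bounded_linear T by fact
  interpret l: bounded_linear l by fact
  \<comment> \<open>Writing \<open>K\<close> as \<open>T\<close> after a bounded map lets it inherit
    compactness; the division by \<open>\<kappa>\<^sub>0\<close> is undone by the eigenvalue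
    equation for \<phi>.\<close>
  define K where "K x = T (x - (l x / \<kappa>\<^sub>0) *\<^sub>R \<phi>)" for x
  have K_eq: "K x = T x - l x *\<^sub>R \<phi>" for x
    using \<kappa>\<^sub>0 by (simp add: K_def T.diff T.scaleR \<phi>)
  have bl: "bounded_linear (\<lambda>x. x - (l x / \<kappa>\<^sub>0) *\<^sub>R \<phi>)"
    by (intro bounded_linear_sub bounded_linear_ident bounded_linear_scaleR_const
        bounded_linear_divide[THEN bounded_linear_compose] l(1))
  have K_bl: "bounded_linear K"
    unfolding K_def by (rule bounded_linear_compose[OF T(1) bl])
  have K_compact: "compact_map K"
    unfolding compact_map_def
  proof (intro allI impI)
    fix x :: "nat \<Rightarrow> 'a" assume "bounded (range x)"
    then have "bounded (range (\<lambda>n. x n - (l (x n) / \<kappa>\<^sub>0) *\<^sub>R \<phi>))"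
      using bounded_linear_image[OF _ bl, of "range x"] by (simp add: image_comp o_def)
    then show "\<exists>r y. strict_mono r \<and> (\<lambda>n. K (x (r n))) \<longlonglongrightarrow> y"
      using T(2) unfolding compact_map_def K_def by blast
  qed
  have inj: "x = 0" if x: "\<kappa>\<^sub>0 *\<^sub>R x - K x = 0" for x
  proof -
    \<comment> \<open>\<open>l\<close> sees only the rank-one term. So a kernel element has
      \<open>l x = 0\<close>, is an eigenvector of \<open>T\<close>, and by simplicity is a multiple
      of \<phi> on which \<open>l\<close> vanishes.\<close>
    have "l (\<kappa>\<^sub>0 *\<^sub>R x - K x) = l x" by (simp add: K_eq l.diff l.scaleR l(2,3))
    then have "l x = 0" using x by simp
    then have "T x = \<kappa>\<^sub>0 *\<^sub>R x" using x by (simp add: K_eq)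
    then obtain c where "x = c *\<^sub>R \<phi>" using simple by blast
    then show ?thesis using \<open>l x = 0\<close> l(3) by (simp add: l.scaleR)
  qed
  obtain S where S: "bounded_linear S" "\<And>y. \<kappa>\<^sub>0 *\<^sub>R S y - K (S y) = y"
    using Fredholm_alternative[OF K_bl K_compact \<kappa>\<^sub>0 inj] by blast
  interpret S: bounded_linear S by fact
  define Q where "Q y = y - l y *\<^sub>R \<phi>" for y
  have "bounded_linear Q" unfolding Q_def
    by (intro bounded_linear_sub bounded_linear_ident bounded_linear_scaleR_const l(1))
  then interpret Q: bounded_linear Q .
  obtain a where a: "a > 0" "\<And>x. norm (S x) \<le> a * norm x"
    using S.pos_bounded by (auto simp: mult.commute)
  obtain b where b: "b > 0" "\<And>x. \<bar>l x\<bar> \<le> b * norm x"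
    using l.pos_bounded by (auto simp: mult.commute)
  obtain q where q: "q > 0" "\<And>x. norm (Q x) \<le> q * norm x"
    using Q.pos_bounded by (auto simp: mult.commute)
  \<comment> \<open>\<open>F\<close> bounds the norm of \<phi> + w for w in the unit ball. In
    \<open>C\<close>, \<open>a\<close> comes from \<open>S\<close>, \<open>b * F + b\<close> from
    the product \<mu> w and \<open>q * F\<close> from the projected remainder. The two entries of
    \<eta> yield the contraction factor 1/2 and |\<mu>| < min \<epsilon> 1.\<close>
  define F where "F = norm \<phi> + 1"
  have F: "F \<ge> 1" by (simp add: F_def)
  define C where "C = a * (b * F + b + q * F)"
  have C: "C > 0" using a b q F by (simp add: C_def add_pos_pos)
  define \<eta> where "\<eta> = min (1 / (2 * C)) (min \<epsilon> 1 / (2 * b * F))"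
  have \<eta>: "\<eta> > 0" using C \<epsilon> b F by (simp add: \<eta>_def)
  have C\<eta>: "C * \<eta> \<le> 1 / 2"
    using C mult_left_mono[of \<eta> "1 / (2 * C)" C] by (simp add: \<eta>_def)
  have b\<eta>: "b * (\<eta> * F) < min \<epsilon> 1"
  proof -
    have "b * F * \<eta> \<le> b * F * (min \<epsilon> 1 / (2 * b * F))"
      using b F by (intro mult_left_mono) (auto simp: \<eta>_def)
    also have "\<dots> = min \<epsilon> 1 / 2" using b F by simp
    also have "\<dots> < min \<epsilon> 1" using \<epsilon> by (simp add: min_def split: if_splits)
    finally show ?thesis by (simp add: mult_ac)
  qed
  obtain r where r: "r > 0"
    "\<And>x y. norm x \<le> r \<Longrightarrow> norm y \<le> r \<Longrightarrow> norm (R x - R y) \<le> \<eta> * norm (x - y)"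
    using R[OF \<eta>] by blast
  \<comment> \<open>Keeps s (\<phi> + w) in the ball where \<open>R\<close> has Lipschitz constant
    \<eta>; the half makes its norm strictly smaller than \<epsilon>.\<close>
  define s where "s = min r (\<epsilon> / 2) / F"
  have s: "s > 0" "s * F \<le> r" "s * F < \<epsilon>"
    using r \<epsilon> F by (auto simp: s_def)
  have scaled: "norm (v /\<^sub>R s) \<le> k" if "norm v \<le> s * k" for v :: 'a and k
    using that s(1) by (simp add: field_simps)
  \<comment> \<open>Scaling by \<open>s\<close> inside and by its inverse outside preserves the
    Lipschitz constant, so the bounds below do not involve \<open>s\<close>.\<close>
  define P where "P w = R (s *\<^sub>R (\<phi> + w)) /\<^sub>R s" for w
  have small: "norm (s *\<^sub>R (\<phi> + w)) \<le> s * F" if "norm w \<le> 1" for w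
    using s that norm_triangle_ineq[of \<phi> w] by (simp add: F_def)
  have P_lip: "norm (P w - P w') \<le> \<eta> * norm (w - w')" if "norm w \<le> 1" "norm w' \<le> 1" for w w'
  proof -
    have "norm (R (s *\<^sub>R (\<phi> + w)) - R (s *\<^sub>R (\<phi> + w'))) \<le> \<eta> * norm (s *\<^sub>R (\<phi> + w) - s *\<^sub>R (\<phi> + w'))"
      using small that s by (intro r(2)) (meson order_trans)+
    also have "s *\<^sub>R (\<phi> + w) - s *\<^sub>R (\<phi> + w') = s *\<^sub>R (w - w')" by (simp add: algebra_simps)
    finally have "norm (R (s *\<^sub>R (\<phi> + w)) - R (s *\<^sub>R (\<phi> + w'))) \<le> s * (\<eta> * norm (w - w'))"
      using s by (simp add: mult_ac)
    moreover have "P w - P w' = (R (s *\<^sub>R (\<phi> + w)) - R (s *\<^sub>R (\<phi> + w'))) /\<^sub>R s"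
      by (simp add: P_def scaleR_diff_right)
    ultimately show ?thesis using scaled by simp
  qed
  have P_bound: "norm (P w) \<le> \<eta> * F" if "norm w \<le> 1" for w
  proof -
    have "norm (R (s *\<^sub>R (\<phi> + w)) - R 0) \<le> \<eta> * norm (s *\<^sub>R (\<phi> + w) - 0)"
      using order_trans[OF small[OF that] s(2)] r(1) by (intro r(2)) simp_all
    also have "\<dots> \<le> \<eta> * (s * F)" using small[OF that] \<eta> by (intro mult_left_mono) auto
    finally have "norm (R (s *\<^sub>R (\<phi> + w))) \<le> s * (\<eta> * F)" by (simp add: R0 mult_ac)
    then show ?thesis unfolding P_def by (rule scaled)
  qed
  define \<mu> where "\<mu> w = l (P w)" for w
  have \<mu>_bound: "\<bar>\<mu> w\<bar> \<le> b * (\<eta> * F)" if "norm w \<le> 1" for w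
    unfolding \<mu>_def using b(2) P_bound[OF that] b(1) by (meson mult_left_mono order_trans less_imp_le)
  have \<mu>_lip: "\<bar>\<mu> w - \<mu> w'\<bar> \<le> b * (\<eta> * norm (w - w'))" if "norm w \<le> 1" "norm w' \<le> 1" for w w'
    unfolding \<mu>_def l.diff[symmetric]
    using b(2) P_lip[OF that] b(1) by (meson mult_left_mono order_trans less_imp_le)
  define \<Phi> where "\<Phi> w = S (Q (P w) - \<mu> w *\<^sub>R w)" for w
  have \<Phi>_lip: "norm (\<Phi> w - \<Phi> w') \<le> 1 / 2 * norm (w - w')" if w: "norm w \<le> 1" "norm w' \<le> 1" for w w'
  proof -
    have "\<mu> w *\<^sub>R w - \<mu> w' *\<^sub>R w' = \<mu> w *\<^sub>R (w - w') + (\<mu> w - \<mu> w') *\<^sub>R w'"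
      by (simp add: algebra_simps)
    then have "norm (\<mu> w *\<^sub>R w - \<mu> w' *\<^sub>R w') \<le> \<bar>\<mu> w\<bar> * norm (w - w') + \<bar>\<mu> w - \<mu> w'\<bar> * norm w'"
      using norm_triangle_ineq by (metis norm_scaleR)
    also have "\<dots> \<le> b * (\<eta> * F) * norm (w - w') + b * (\<eta> * norm (w - w')) * 1"
      using \<mu>_bound[OF w(1)] \<mu>_lip[OF w] w(2) b(1) \<eta>
      by (intro add_mono mult_mono) auto
    finally have 1: "norm (\<mu> w *\<^sub>R w - \<mu> w' *\<^sub>R w') \<le> (b * F + b) * \<eta> * norm (w - w')"
      by (simp add: algebra_simps)
    have "norm (Q (P w - P w')) \<le> q * (\<eta> * norm (w - w'))"
      using q P_lip[OF w] by (meson mult_left_mono order_trans less_imp_le)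
    \<comment> \<open>Inserting \<open>F\<close>, which is at least 1, lets the same
      \<open>C\<close> serve for the contraction and for the self-map bound.\<close>
    also have "\<dots> \<le> q * F * \<eta> * norm (w - w')"
    proof -
      have "q * \<eta> * norm (w - w') * 1 \<le> q * \<eta> * norm (w - w') * F"
        using q \<eta> F by (intro mult_left_mono) auto
      then show ?thesis by (simp add: mult_ac)
    qed
    finally have 2: "norm (Q (P w - P w')) \<le> q * F * \<eta> * norm (w - w')" .
    have "\<Phi> w - \<Phi> w' = S (Q (P w - P w') - (\<mu> w *\<^sub>R w - \<mu> w' *\<^sub>R w'))"
      unfolding \<Phi>_def S.diff[symmetric] by (simp add: Q.diff algebra_simps)
    then have "norm (\<Phi> w - \<Phi> w') \<le> a * norm (Q (P w - P w') - (\<mu> w *\<^sub>R w - \<mu> w' *\<^sub>R w'))"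
      using a by metis
    also have "\<dots> \<le> a * (q * F * \<eta> * norm (w - w') + (b * F + b) * \<eta> * norm (w - w'))"
      using a(1) order_trans[OF norm_triangle_ineq4 add_mono[OF 2 1]] by (intro mult_left_mono) auto
    also have "\<dots> = C * \<eta> * norm (w - w')" by (simp add: C_def algebra_simps)
    also have "\<dots> \<le> 1 / 2 * norm (w - w')" using C\<eta> by (intro mult_right_mono) auto
    finally show ?thesis .
  qed
  have \<Phi>_self: "norm (\<Phi> w) \<le> 1" if w: "norm w \<le> 1" for w
  proof -
    have "norm (\<mu> w *\<^sub>R w) \<le> b * (\<eta> * F) * 1"
      using \<mu>_bound[OF w] w by (simp only: norm_scaleR) (intro mult_mono, auto)
    moreover have "norm (Q (P w)) \<le> q * (\<eta> * F)"
      using q P_bound[OF w] by (meson mult_left_mono order_trans less_imp_le)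
    ultimately have "norm (Q (P w) - \<mu> w *\<^sub>R w) \<le> q * (\<eta> * F) + b * (\<eta> * F)"
      using norm_triangle_ineq4[of "Q (P w)" "\<mu> w *\<^sub>R w"] by linarith
    also have "\<dots> \<le> (b * F + b + q * F) * \<eta>" using b \<eta> by (simp add: algebra_simps)
    finally have "a * norm (Q (P w) - \<mu> w *\<^sub>R w) \<le> a * ((b * F + b + q * F) * \<eta>)"
      using a by (intro mult_left_mono) auto
    also have "\<dots> = C * \<eta>" by (simp add: C_def)
    finally show ?thesis using C\<eta> a(2)[of "Q (P w) - \<mu> w *\<^sub>R w"] unfolding \<Phi>_def by linarith
  qed
  have "\<exists>!w\<in>cball 0 1. \<Phi> w = w"
    by (rule Banach_fix[of _ "1 / 2"])
      (use \<Phi>_self \<Phi>_lip in \<open>simp_all add: dist_norm complete_eq_closed image_subset_iff\<close>)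
  then obtain w where w: "norm w \<le> 1" "\<Phi> w = w" by auto
  have \<mu>w: "\<bar>\<mu> w\<bar> < \<epsilon>" "\<bar>\<mu> w\<bar> < 1" using \<mu>_bound[OF w(1)] b\<eta> by auto
  have eq: "\<kappa>\<^sub>0 *\<^sub>R w - T w + l w *\<^sub>R \<phi> = P w - \<mu> w *\<^sub>R \<phi> - \<mu> w *\<^sub>R w"
    using S(2)[of "Q (P w) - \<mu> w *\<^sub>R w"] w(2) by (simp add: \<Phi>_def K_eq Q_def \<mu>_def algebra_simps)
  \<comment> \<open>Under \<open>l\<close> the part from \<open>\<kappa>\<^sub>0\<close> - T
    vanishes and \<open>l (P w)\<close> cancels against \<mu>. What remains is (1 + \<mu>) l w = 0,
    and |\<mu>| < 1 gives l w = 0.\<close>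
  have "l (\<kappa>\<^sub>0 *\<^sub>R w - T w + l w *\<^sub>R \<phi>) = l w"
    by (simp add: l.diff l.add l.scaleR l(2,3))
  moreover have "l (P w - \<mu> w *\<^sub>R \<phi> - \<mu> w *\<^sub>R w) = - \<mu> w * l w"
    by (simp add: l.diff l.scaleR l(3) \<mu>_def)
  ultimately have "l w = - \<mu> w * l w" using eq by simp
  then have "(1 + \<mu> w) * l w = 0" by (simp add: algebra_simps)
  then have lw: "l w = 0" using \<mu>w(2) by auto
  let ?x = "s *\<^sub>R (\<phi> + w)"
  have "l ?x = s" by (simp add: l.scaleR l.add lw l(3))
  then have "?x \<noteq> 0" using s(1) by auto
  moreover have "norm ?x < \<epsilon>" using small[OF w(1)] s(3) by simp
  moreover have "(\<kappa>\<^sub>0 + \<mu> w) *\<^sub>R ?x = T ?x + R ?x"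
  proof -
    have "R ?x = s *\<^sub>R P w" using s(1) by (simp add: P_def)
    moreover have "(\<kappa>\<^sub>0 + \<mu> w) *\<^sub>R (\<phi> + w) = T \<phi> + T w + P w"
      using eq lw by (simp add: \<phi> algebra_simps)
    ultimately show ?thesis
      by (metis T.add T.scaleR scaleR_add_right scaleR_left_commute)
  qed
  ultimately show thesis using that[of ?x "\<kappa>\<^sub>0 + \<mu> w"] \<mu>w(1) by simp
qed

text \<open>The abstract theorem is stated for the class \<open>banach\<close> and will be applied
  to potentials with the supremum norm.\<close>

instance bcontfun :: (metric_space, banach) banach ..

section \<open>Measure theory on the cylinder\<close>

lemma complete_measure_lebesgue_on:
  assumes "S \<in> sets lebesgue"
  shows "complete_measure (lebesgue_on S)"
proof
  fix A B assume "B \<subseteq> A" "A \<in> null_sets (lebesgue_on S)"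
  then have "B \<subseteq> S" "B \<in> null_sets lebesgue"
    using assms null_sets_restrict_space[of S lebesgue] null_sets_completion_subset[of B A lborel] by auto
  then show "B \<in> sets (lebesgue_on S)"
    using assms null_sets_restrict_space[of S lebesgue B] by auto
qed

lemma (in complete_measure) borel_measurable_cong_AE:
  assumes "f \<in> M \<rightarrow>\<^sub>M N" "AE x in M. f x = g x" "\<And>x. x \<in> space M \<Longrightarrow> g x \<in> space N"
  shows "g \<in> M \<rightarrow>\<^sub>M N"
proof (rule measurableI)
  fix A assume "A \<in> sets N"
  then have "f -` A \<inter> space M \<in> sets M" using assms(1) by measurable
  moreover have "AE x in M. x \<in> f -` A \<inter> space M \<longleftrightarrow> x \<in> g -` A \<inter> space M"
    using assms(2) by eventually_elim auto
  ultimately show "g -` A \<inter> space M \<in> sets M" using in_sets_AE by blast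
qed (use assms(3) in auto)

text \<open>Completeness transfers measurability in both directions. If one function is not
  measurable, neither is the other, and both integrals have the default value 0.\<close>

lemma (in complete_measure) integral_cong_AE_complete:
  fixes f g :: "'a \<Rightarrow> 'b::{banach, second_countable_topology}"
  assumes "AE x in M. f x = g x"
  shows "integral\<^sup>L M f = integral\<^sup>L M g"
proof (cases "f \<in> borel_measurable M")
  case True
  then show ?thesis using borel_measurable_cong_AE[OF True assms] assms by (intro integral_cong_AE) auto
next
  case False
  moreover have "g \<notin> borel_measurable M"
    using False borel_measurable_cong_AE[of g borel f] assms by (auto simp: eq_commute)
  ultimately show ?thesis by (metis borel_measurable_integrable not_integrable_integral_eq)
qed

lemma (in complete_measure) integrable_cong_AE_complete:
  fixes f g :: "'a \<Rightarrow> 'b::{banach, second_countable_topology}"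
  assumes "AE x in M. f x = g x" "integrable M f"
  shows "integrable M g"
proof -
  have "g \<in> borel_measurable M"
    using assms borel_measurable_cong_AE[of f borel g] by auto
  then show ?thesis using assms integrable_cong_AE[of f M g] by auto
qed

lemma measurable_ident_lebesgue_on:
  fixes S :: "'a::euclidean_space set"
  shows "(\<lambda>x. x) \<in> lebesgue_on S \<rightarrow>\<^sub>M borel"
  by (intro measurable_restrict_space1 measurable_completion) simp

lemma borel_measurable_lebesgue_onI:
  "f \<in> borel_measurable borel \<Longrightarrow> f \<in> borel_measurable (lebesgue_on S)"
  using measurable_compose[OF measurable_ident_lebesgue_on] .

interpretation circle: finite_measure circle
  by (rule finite_measure_lebesgue_on) auto

interpretation unit_interval: finite_measure unit_interval
  by (rule finite_measure_lebesgue_on) auto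

lemma cylinder_lmeasurable: "{0..2*pi} \<times> {0..1::real} \<in> lmeasurable"
  using lmeasurable_cbox[of "(0::real, 0::real)" "(2*pi, 1)"] by (simp add: cbox_Pair_eq)

lemma cylinder_in_sets [simp]: "{0..2*pi} \<times> {0..1::real} \<in> sets lebesgue"
  using cylinder_lmeasurable by (rule fmeasurableD)

interpretation cylinder: finite_measure cylinder
  by (rule finite_measure_lebesgue_on) (rule cylinder_lmeasurable)

interpretation circle: complete_measure circle
  by (rule complete_measure_lebesgue_on) auto

interpretation unit_interval: complete_measure unit_interval
  by (rule complete_measure_lebesgue_on) auto

lemma measure_circle [simp]: "measure circle {0..2*pi} = 2 * pi"
  by (simp add: measure_restrict_space)

lemma measure_unit_interval [simp]: "measure unit_interval {0..1} = 1"
  by (simp add: measure_restrict_space)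

text \<open>Exchanging two almost-everywhere quantifiers needs a measurable set, so the exceptional
  set is first enlarged to a Borel null set \<open>N\<close>.\<close>

lemma AE_lborel_pair_swap:
  assumes "AE p in lborel. Q (p :: real \<times> real)"
  shows "AE y in lborel. AE x in lborel. Q (x, y)"
proof -
  obtain N where N: "{p. \<not> Q p} \<subseteq> N" "N \<in> sets lborel" "emeasure lborel N = 0"
    using AE_E[OF assms] by auto
  have sets: "N \<in> sets (lborel \<Otimes>\<^sub>M lborel)" using N(2) by (simp only: lborel_prod)
  have "{p. p \<notin> N} = space (lborel \<Otimes>\<^sub>M lborel) - N" by (auto simp: space_pair_measure)
  then have compl: "{p. p \<notin> N} \<in> sets (lborel \<Otimes>\<^sub>M lborel)" using sets.compl_sets[OF sets] by metis
  have "AE p in lborel \<Otimes>\<^sub>M lborel. p \<notin> N"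
    using AE_not_in[of N lborel] N by (simp only: lborel_prod) (auto simp: null_sets_def)
  then have "AE x in lborel. AE y in lborel. (x, y) \<notin> N" by (rule lborel_pair.AE_pair)
  then have "AE y in lborel. AE x in lborel. (x, y) \<notin> N"
    using lborel_pair.AE_commute[of "\<lambda>x y. (x, y) \<notin> N"] compl
    by (simp only: prod.collapse) (simp add: space_pair_measure)
  then show ?thesis
  proof eventually_elim
    case (elim y)
    then show ?case by eventually_elim (use N(1) in blast)
  qed
qed

lemma AE_lborel_pair:
  assumes "AE p in lborel. Q (p :: real \<times> real)"
  shows "AE x in lborel. AE y in lborel. Q (x, y)"
  using assms by (intro lborel_pair.AE_pair) (simp only: lborel_prod)

lemma AE_lebesgue_on_pair:
  assumes "A \<in> sets lebesgue" "B \<in> sets lebesgue"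
    and "AE x in lborel. AE y in lborel. x \<in> A \<longrightarrow> y \<in> B \<longrightarrow> P x y"
  shows "AE x in lebesgue_on A. AE y in lebesgue_on B. P x y"
proof -
  have "AE x in lborel. x \<in> A \<longrightarrow> (AE y in lebesgue_on B. P x y)"
    using assms(3)
  proof eventually_elim
    case (elim x)
    show ?case
    proof
      assume "x \<in> A"
      then have "AE y in lborel. y \<in> B \<longrightarrow> P x y"
        by (intro eventually_mono[OF elim]) auto
      then show "AE y in lebesgue_on B. P x y"
        using assms(2) by (simp add: AE_restrict_space_iff AE_completion_iff)
    qed
  qed
  then show ?thesis using assms(1) by (simp add: AE_restrict_space_iff AE_completion_iff)
qed

text \<open>\<open>cylinder\<close> restricts the completed measure on the plane and is not a
  product measure, hence the detour through \<open>lborel\<close>. The outer quantifier runs over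
  the second coordinate, as does the outer integral in \<open>interaction\<close>.\<close>

lemma AE_cylinder_sections:
  assumes "AE p in cylinder. Q p"
  shows "AE y in unit_interval. AE v in circle. Q (v, y)"
proof (rule AE_lebesgue_on_pair)
  have "AE p in lborel. p \<in> {0..2*pi} \<times> {0..1} \<longrightarrow> Q p"
    using assms cylinder_in_sets by (simp add: AE_restrict_space_iff AE_completion_iff)
  from AE_lborel_pair_swap[OF this]
  show "AE y in lborel. AE v in lborel. y \<in> {0..1} \<longrightarrow> v \<in> {0..2*pi} \<longrightarrow> Q (v, y)"
  proof eventually_elim
    case (elim y)
    then show ?case by eventually_elim auto
  qed
qed auto

lemma Fubini_bounded:
  fixes k :: "'a \<Rightarrow> 'b \<Rightarrow> real"
  assumes "finite_measure M" "finite_measure N" "(\<lambda>(x, y). k x y) \<in> borel_measurable (M \<Otimes>\<^sub>M N)"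
    and K: "\<And>x y. x \<in> space M \<Longrightarrow> y \<in> space N \<Longrightarrow> \<bar>k x y\<bar> \<le> K"
  shows "(LINT x|M. LINT y|N. k x y) = (LINT y|N. LINT x|M. k x y)"
proof -
  interpret M: finite_measure M by fact
  interpret N: finite_measure N by fact
  interpret MN: pair_sigma_finite M N ..
  interpret P: finite_measure "M \<Otimes>\<^sub>M N" by (rule finite_measure_pair_measure) unfold_locales
  have "integrable (M \<Otimes>\<^sub>M N) (\<lambda>(x, y). k x y)"
    using assms(3) K by (intro P.integrable_const_bound[where B=K]) (auto simp: space_pair_measure)
  then show ?thesis by (rule MN.Fubini_integral[symmetric])
qed

text \<open>The affine change of variables holds for arbitrary functions, both sides being 0 when
  the integral does not exist.\<close>

lemma integral_circle_reflect:
  fixes h :: "real \<Rightarrow> real"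
  shows "(LINT v|circle. h (2*pi - v)) = (LINT v|circle. h v)"
proof -
  have "(LINT v|circle. h v) = (LINT v|lebesgue. indicator {0..2*pi} v *\<^sub>R h v)"
    by (simp add: integral_restrict_space)
  also have "\<dots> = (LINT v|lebesgue. indicator {0..2*pi} (2*pi - v) *\<^sub>R h (2*pi - v))"
    using lebesgue_integral_real_affine[of "-1" "\<lambda>v. indicator {0..2*pi} v *\<^sub>R h v" "2*pi"] by simp
  also have "(\<lambda>v::real. indicator {0..2*pi} (2*pi - v)) = (indicator {0..2*pi} :: real \<Rightarrow> real)"
    by (auto simp: indicator_def fun_eq_iff)
  finally show ?thesis by (simp add: integral_restrict_space fun_eq_iff)
qed

section \<open>The symmetrised interaction\<close>

lemma abs_integral_circle_le:
  assumes "\<And>v. v \<in> {0..2*pi} \<Longrightarrow> \<bar>h v\<bar> \<le> K" 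
  shows "\<bar>LINT v|circle. h v\<bar> \<le> 2 * pi * K"
proof -
  have "0 \<le> K" using order_trans[OF abs_ge_zero assms[of 0]] by simp
  then have "(LINT v|circle. \<bar>h v\<bar>) \<le> (LINT v|circle. K)"
    using assms by (intro integral_mono') auto
  also have "\<dots> = 2 * pi * K" by simp
  finally show ?thesis using integral_abs_bound[of circle h] by linarith
qed

text \<open>Borel rather than Lebesgue measurability: sections and compositions then stay measurable
  without exceptional sets. The explicit bound makes the estimates below uniform in
  \<open>f\<close>.\<close>

definition bounded_borel :: "('a::topological_space \<Rightarrow> real) \<Rightarrow> real \<Rightarrow> bool" where
  "bounded_borel f B \<longleftrightarrow> f \<in> borel_measurable borel \<and> (\<forall>p. \<bar>f p\<bar> \<le> B)"

lemma bounded_borel_nonneg: "bounded_borel f B \<Longrightarrow> B \<ge> 0"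
  using order_trans[OF abs_ge_zero] by (auto simp: bounded_borel_def)

lemma bounded_borel_add:
  "bounded_borel f A \<Longrightarrow> bounded_borel g B \<Longrightarrow> bounded_borel (\<lambda>p. f p + g p) (A + B)"
  unfolding bounded_borel_def by (auto intro: order_trans[OF abs_triangle_ineq] add_mono)

lemma bounded_borel_scale:
  "bounded_borel f A \<Longrightarrow> bounded_borel (\<lambda>p. c * f p) (\<bar>c\<bar> * A)"
  unfolding bounded_borel_def by (auto simp: abs_mult intro: mult_left_mono)

lemma bounded_borel_mono: "bounded_borel f A \<Longrightarrow> A \<le> B \<Longrightarrow> bounded_borel f B"
  unfolding bounded_borel_def by (meson order_trans)

lemma bounded_borel_abs: "bounded_borel f B \<Longrightarrow> \<bar>f p\<bar> \<le> B"
  by (simp add: bounded_borel_def)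

lemma bounded_borel_measurable_pair:
  fixes f :: "'a::second_countable_topology \<times> 'b::second_countable_topology \<Rightarrow> real"
  assumes "bounded_borel f B"
  shows "f \<in> borel_measurable (borel \<Otimes>\<^sub>M borel)"
  using assms by (simp add: bounded_borel_def borel_prod)

lemma bounded_borel_section:
  fixes f :: "'a::second_countable_topology \<times> 'b::second_countable_topology \<Rightarrow> real"
  assumes "bounded_borel f B"
  shows "bounded_borel (\<lambda>v. f (v, y)) B"
proof -
  note bounded_borel_measurable_pair[OF assms, measurable]
  have "(\<lambda>v. f (v, y)) \<in> borel_measurable borel" by measurable
  then show ?thesis using assms by (simp add: bounded_borel_def)
qed

lemma bounded_borel_bcontfun:
  "bounded_borel (apply_bcontfun h) (norm h)"
  unfolding bounded_borel_def using norm_bounded[of h]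
  by (auto intro: borel_measurable_continuous_onI)

lemma measurable_fst_lebesgue_on [measurable]:
  "(\<lambda>x. fst x) \<in> lebesgue_on (S::'b::euclidean_space set) \<Otimes>\<^sub>M N \<rightarrow>\<^sub>M borel"
  using measurable_compose[OF measurable_fst measurable_ident_lebesgue_on] .

lemma measurable_snd_lebesgue_on [measurable]:
  "(\<lambda>x. snd x) \<in> N \<Otimes>\<^sub>M lebesgue_on (S::'b::euclidean_space set) \<rightarrow>\<^sub>M borel"
  using measurable_compose[OF measurable_snd measurable_ident_lebesgue_on] .

text \<open>Lebesgue measurability on the square gives measurable sections only for almost every
  \<open>x\<close>, while \<open>interaction\<close> is evaluated at each \<open>x\<close>; hence
  \<open>W_section_measurable\<close>. The joint assumption serves the exchange of integrals in
  \<open>W_Fubini\<close>.\<close>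

locale interaction_kernel =
  fixes W :: "real \<Rightarrow> real \<Rightarrow> real" and D :: "real \<Rightarrow> real" and L :: real
  assumes W_range: "x \<in> {0..1} \<Longrightarrow> y \<in> {0..1} \<Longrightarrow> 0 \<le> W x y \<and> W x y \<le> 1"
    and W_sym: "x \<in> {0..1} \<Longrightarrow> y \<in> {0..1} \<Longrightarrow> W x y = W y x"
    and W_measurable: "(\<lambda>(x, y). W x y) \<in> borel_measurable (lebesgue_on ({0..1} \<times> {0..1}))"
    and W_section_measurable: "x \<in> {0..1} \<Longrightarrow> W x \<in> borel_measurable unit_interval"
    and W_continuous: "\<And>\<epsilon>. \<epsilon> > 0 \<Longrightarrow> \<exists>\<delta>>0. \<forall>x\<^sub>1\<in>{0..1}. \<forall>x\<^sub>2\<in>{0..1}. \<bar>x\<^sub>1 - x\<^sub>2\<bar> < \<delta> \<longrightarrow>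
          (LINT y|unit_interval. \<bar>W x\<^sub>1 y - W x\<^sub>2 y\<bar>) < \<epsilon>"
    and D_lipschitz: "L-lipschitz_on {0..2*pi} D"
    and D_even: "\<And>u. D (- u) = D u"
    and D_periodic: "\<And>u. D (u + 2*pi) = D u"
begin

text \<open>The Lipschitz hypothesis concerns one period; clamping the argument gives a function
  that agrees with \<open>D\<close> there and is Lipschitz and bounded on the whole line.\<close>

definition Dc :: "real \<Rightarrow> real" where
  "Dc t = D (max 0 (min t (2*pi)))"

definition D_mean :: real where
  "D_mean = (LINT v|circle. Dc v) / (2*pi)"

text \<open>For angles in [0, 2 pi] this is (D (u - v) + D (u + v)) / 2 minus the mean of
  \<open>D\<close>. Evenness and periodicity allow the arguments |u - v| and |u + v - 2 pi|, which
  stay in [0, 2 pi], where \<open>Dc\<close> equals \<open>D\<close>.\<close>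

definition even_kernel :: "real \<Rightarrow> real \<Rightarrow> real" where
  "even_kernel u v = (Dc \<bar>u - v\<bar> + Dc \<bar>u + v - 2*pi\<bar>) / 2 - D_mean"

definition kernel_bound :: real where
  "kernel_bound = \<bar>D 0\<bar> + 2 * pi * L + \<bar>D_mean\<bar>"

lemma L_nonneg: "L \<ge> 0"
  using D_lipschitz lipschitz_on_nonneg by blast

lemma Dc_lipschitz: "\<bar>Dc s - Dc t\<bar> \<le> L * \<bar>s - t\<bar>"
proof -
  have "\<bar>Dc s - Dc t\<bar> \<le> L * \<bar>max 0 (min s (2*pi)) - max 0 (min t (2*pi))\<bar>"
    using lipschitz_onD[OF D_lipschitz, of "max 0 (min s (2*pi))" "max 0 (min t (2*pi))"]
    by (auto simp: Dc_def dist_real_def)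
  also have "\<dots> \<le> L * \<bar>s - t\<bar>"
    using L_nonneg by (intro mult_left_mono) auto
  finally show ?thesis .
qed

lemma Dc_bound: "\<bar>Dc t\<bar> \<le> \<bar>D 0\<bar> + 2 * pi * L"
proof -
  have "Dc t = Dc (max 0 (min t (2*pi)))" by (simp add: Dc_def)
  then have "\<bar>Dc t - Dc 0\<bar> \<le> L * \<bar>max 0 (min t (2*pi)) - 0\<bar>" using Dc_lipschitz by metis
  also have "\<dots> \<le> L * (2 * pi)" using L_nonneg by (intro mult_left_mono) auto
  finally show ?thesis by (simp add: Dc_def mult_ac)
qed

lemma continuous_on_Dc: "continuous_on S Dc"
proof (rule lipschitz_on_continuous_on)
  show "L-lipschitz_on S Dc" using Dc_lipschitz L_nonneg by (auto simp: lipschitz_on_def dist_real_def)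
qed

lemma Dc_measurable [measurable]: "Dc \<in> borel_measurable borel"
  using continuous_on_Dc by (rule borel_measurable_continuous_onI)

lemma even_kernel_measurable [measurable (raw)]:
  "f \<in> borel_measurable M \<Longrightarrow> g \<in> borel_measurable M \<Longrightarrow> (\<lambda>x. even_kernel (f x) (g x)) \<in> borel_measurable M"
  unfolding even_kernel_def
  by (intro borel_measurable_diff borel_measurable_divide borel_measurable_add borel_measurable_const
      measurable_compose[OF _ Dc_measurable] borel_measurable_abs)

lemma kernel_bound_nonneg: "kernel_bound \<ge> 0"
  using L_nonneg by (simp add: kernel_bound_def)

lemma even_kernel_bound: "\<bar>even_kernel u v\<bar> \<le> kernel_bound"
proof -
  have "\<bar>(a + b) / 2 - m\<bar> \<le> K + \<bar>m\<bar>" if "\<bar>a\<bar> \<le> K" "\<bar>b\<bar> \<le> K" for a b m K :: real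
  proof -
    have "\<bar>(a + b) / 2\<bar> \<le> K"
      using abs_le_D1[OF that(1)] abs_le_D2[OF that(1)] abs_le_D1[OF that(2)] abs_le_D2[OF that(2)] by (intro abs_leI) (simp_all add: field_simps)
    then show ?thesis using abs_triangle_ineq4[of "(a + b) / 2" m] by linarith
  qed
  then show ?thesis
    unfolding even_kernel_def kernel_bound_def using Dc_bound by blast
qed

lemma even_kernel_sym: "even_kernel u v = even_kernel v u"
  by (simp add: even_kernel_def abs_minus_commute add.commute)

text \<open>Reflecting u exchanges the two arguments of \<open>Dc\<close>.\<close>

lemma even_kernel_reflect: "even_kernel (2*pi - u) v = even_kernel u v"
proof -
  have "\<bar>2*pi - u - v\<bar> = \<bar>u + v - 2*pi\<bar>" "\<bar>2*pi - u + v - 2*pi\<bar> = \<bar>u - v\<bar>" by auto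
  then show ?thesis by (simp add: even_kernel_def)
qed

lemma even_kernel_lipschitz: "\<bar>even_kernel u v - even_kernel u' v\<bar> \<le> L * \<bar>u - u'\<bar>"
proof -
  have "\<bar>(Dc \<bar>u - v\<bar>) - (Dc \<bar>u' - v\<bar>)\<bar> \<le> L * \<bar>u - u'\<bar>"
    using order_trans[OF Dc_lipschitz mult_left_mono[OF _ L_nonneg]] by force
  moreover have "\<bar>(Dc \<bar>u + v - 2*pi\<bar>) - (Dc \<bar>u' + v - 2*pi\<bar>)\<bar> \<le> L * \<bar>u - u'\<bar>"
    using order_trans[OF Dc_lipschitz mult_left_mono[OF _ L_nonneg]] by force
  moreover have "\<bar>((a + b) / 2 - m) - ((a' + b') / 2 - m)\<bar> \<le> K"
    if "\<bar>a - a'\<bar> \<le> K" "\<bar>b - b'\<bar> \<le> K" for a a' b b' m K :: real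
  proof -
    have "((a + b) / 2 - m) - ((a' + b') / 2 - m) = ((a - a') + (b - b')) / 2" by argo
    then show ?thesis using abs_le_D1[OF that(1)] abs_le_D2[OF that(1)] abs_le_D1[OF that(2)] abs_le_D2[OF that(2)] by (intro abs_leI) (simp_all add: field_simps)
  qed
  ultimately show ?thesis unfolding even_kernel_def by blast
qed

section \<open>The angular integral and the operator \<open>J\<close>\<close>

definition angular :: "(real \<times> real \<Rightarrow> real) \<Rightarrow> real \<Rightarrow> real \<Rightarrow> real" where
  "angular f u y = (LINT v|circle. even_kernel u v * f (v, y))"

definition J :: "(real \<times> real \<Rightarrow> real) \<Rightarrow> real \<times> real \<Rightarrow> real" where
  "J f = (\<lambda>(u, x). LINT y|unit_interval. LINT v|circle. W x y * even_kernel u v * f (v, y))"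

lemma J_eq: "J f (u, x) = (LINT y|unit_interval. W x y * angular f u y)"
  by (simp add: J_def angular_def mult.assoc)

lemma angular_integrable:
  fixes f :: "real \<times> real \<Rightarrow> real"
  assumes "bounded_borel f B"
  shows "integrable circle (\<lambda>v. even_kernel u v * f (v, y))"
proof (rule circle.integrable_const_bound)
  have [measurable]: "(\<lambda>v. f (v, y)) \<in> borel_measurable borel"
    using bounded_borel_section[OF assms] by (simp add: bounded_borel_def)
  show "(\<lambda>v. even_kernel u v * f (v, y)) \<in> borel_measurable circle"
    by (rule borel_measurable_lebesgue_onI) measurable
  show "AE v in circle. norm (even_kernel u v * f (v, y)) \<le> kernel_bound * B"
    using assms even_kernel_bound kernel_bound_nonneg
    by (auto simp: abs_mult bounded_borel_def intro!: mult_mono)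
qed

lemma angular_measurable:
  assumes "bounded_borel f B" and [measurable]: "g \<in> borel_measurable M" "h \<in> borel_measurable M"
  shows "(\<lambda>p. angular f (g p) (h p)) \<in> borel_measurable M"
proof -
  note bounded_borel_measurable_pair[OF assms(1), measurable]
  show ?thesis unfolding angular_def by measurable
qed

lemma angular_bound:
  fixes f :: "real \<times> real \<Rightarrow> real"
  assumes "bounded_borel f B"
  shows "\<bar>angular f u y\<bar> \<le> 2 * pi * (kernel_bound * B)"
  unfolding angular_def using assms even_kernel_bound kernel_bound_nonneg
  by (intro abs_integral_circle_le) (auto simp: abs_mult bounded_borel_def intro!: mult_mono)

lemma angular_lipschitz:
  fixes f :: "real \<times> real \<Rightarrow> real"
  assumes "bounded_borel f B"
  shows "\<bar>angular f u y - angular f u' y\<bar> \<le> 2 * pi * (L * \<bar>u - u'\<bar> * B)"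
proof -
  have "angular f u y - angular f u' y
      = (LINT v|circle. even_kernel u v * f (v, y) - even_kernel u' v * f (v, y))"
    unfolding angular_def using angular_integrable[OF assms] by simp
  also have "\<bar>\<dots>\<bar> \<le> 2 * pi * (L * \<bar>u - u'\<bar> * B)"
    using assms even_kernel_lipschitz L_nonneg
    by (intro abs_integral_circle_le)
      (auto simp: abs_mult bounded_borel_def left_diff_distrib[symmetric] intro!: mult_mono)
  finally show ?thesis .
qed

lemma angular_add:
  "bounded_borel f B \<Longrightarrow> bounded_borel g C \<Longrightarrow>
    angular (\<lambda>p. f p + g p) u y = angular f u y + angular g u y"
  unfolding angular_def by (simp add: distrib_left angular_integrable)

lemma angular_scale: "angular (\<lambda>p. c * f p) u y = c * angular f u y"
  unfolding angular_def by (simp add: mult.left_commute)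

lemma W_integrable:
  assumes "x \<in> {0..1}" "h \<in> borel_measurable unit_interval" "\<And>y. y \<in> {0..1} \<Longrightarrow> \<bar>h y\<bar> \<le> K"
  shows "integrable unit_interval (\<lambda>y. W x y * h y)"
proof (rule unit_interval.integrable_const_bound)
  show "(\<lambda>y. W x y * h y) \<in> borel_measurable unit_interval"
    using assms W_section_measurable by measurable
  have "\<bar>W x y * h y\<bar> \<le> 1 * K" if "y \<in> {0..1}" for y
    unfolding abs_mult using assms that W_range by (intro mult_mono) auto
  then show "AE y in unit_interval. norm (W x y * h y) \<le> K" by auto
qed

lemma W_angular_integrable:
  assumes "x \<in> {0..1}" "bounded_borel f B"
  shows "integrable unit_interval (\<lambda>y. W x y * angular f u y)"
proof (rule W_integrable[OF assms(1)])
  show "angular f u \<in> borel_measurable unit_interval"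
    using angular_measurable[OF assms(2), of "\<lambda>_. u" unit_interval "\<lambda>y. y"]
    by (simp add: measurable_ident_lebesgue_on)
qed (rule angular_bound[OF assms(2)])

lemma J_add:
  "snd p \<in> {0..1} \<Longrightarrow> bounded_borel f B \<Longrightarrow> bounded_borel g C \<Longrightarrow>
    J (\<lambda>p. f p + g p) p = J f p + J g p"
  by (cases p) (simp add: J_eq angular_add distrib_left W_angular_integrable)

lemma J_scale: "J (\<lambda>p. c * f p) p = c * J f p"
  by (cases p) (simp add: J_eq angular_scale mult.left_commute)

lemma J_bound:
  assumes "snd p \<in> {0..1}" "bounded_borel f B"
  shows "\<bar>J f p\<bar> \<le> 2 * pi * (kernel_bound * B)"
proof (cases p)
  case (Pair u x)
  have K: "0 \<le> 2 * pi * (kernel_bound * B)" using angular_bound[OF assms(2), of u x] by linarith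
  have "\<bar>W x y * angular f u y\<bar> \<le> 1 * (2 * pi * (kernel_bound * B))" if "y \<in> {0..1}" for y
    unfolding abs_mult using assms(1) Pair that W_range[of x y] K angular_bound[OF assms(2)]
    by (intro mult_mono) auto
  then have "(LINT y|unit_interval. \<bar>W x y * angular f u y\<bar>) \<le> (LINT y|unit_interval. 2 * pi * (kernel_bound * B))"
    using K by (intro integral_mono') auto
  also have "\<dots> = 2 * pi * (kernel_bound * B)" by simp
  finally show ?thesis unfolding Pair J_eq by (rule order_trans[OF integral_abs_bound])
qed

text \<open>The modulus of continuity depends on \<open>f\<close> only through \<open>B\<close>: the
  kernel gives the Lipschitz part in the angle, the L^1 continuity of \<open>W\<close> the part in
  \<open>x\<close>.\<close>

lemma J_diff_bound:
  assumes "x \<in> {0..1}" "x' \<in> {0..1}" "bounded_borel f B"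
  shows "\<bar>J f (u, x) - J f (u', x')\<bar> \<le> 2 * pi * (L * \<bar>u - u'\<bar> * B)
    + 2 * pi * (kernel_bound * B) * (LINT y|unit_interval. \<bar>W x y - W x' y\<bar>)"
proof -
  let ?K = "2 * pi * (kernel_bound * B)"
  let ?A = "2 * pi * (L * \<bar>u - u'\<bar> * B)"
  have int: "integrable unit_interval (\<lambda>y. \<bar>W x y - W x' y\<bar>)"
    using W_integrable[OF assms(1), of "\<lambda>_. 1" 1] W_integrable[OF assms(2), of "\<lambda>_. 1" 1] by simp
  have "J f (u, x) - J f (u', x') = (LINT y|unit_interval. W x y * angular f u y - W x' y * angular f u' y)"
    using W_angular_integrable assms by (simp add: J_eq)
  then have "\<bar>J f (u, x) - J f (u', x')\<bar> = \<bar>LINT y|unit_interval. W x y * angular f u y - W x' y * angular f u' y\<bar>"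
    by (rule arg_cong)
  also have "\<dots> \<le> (LINT y|unit_interval. \<bar>W x y * angular f u y - W x' y * angular f u' y\<bar>)"
    by (rule integral_abs_bound)
  also have "\<dots> \<le> (LINT y|unit_interval. ?A + ?K * \<bar>W x y - W x' y\<bar>)"
  proof (rule integral_mono)
    show "integrable unit_interval (\<lambda>y. ?A + ?K * \<bar>W x y - W x' y\<bar>)" using int by simp
    show "integrable unit_interval (\<lambda>y. \<bar>W x y * angular f u y - W x' y * angular f u' y\<bar>)"
      using W_angular_integrable assms by (intro integrable_abs Bochner_Integration.integrable_diff)
    fix y assume "y \<in> space unit_interval"
    then have y: "y \<in> {0..1}" by simp
    have "W x y * angular f u y - W x' y * angular f u' y
      = W x y * (angular f u y - angular f u' y) + (W x y - W x' y) * angular f u' y"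
      by (simp add: algebra_simps)
    then have "\<bar>W x y * angular f u y - W x' y * angular f u' y\<bar>
      \<le> W x y * \<bar>angular f u y - angular f u' y\<bar> + \<bar>W x y - W x' y\<bar> * \<bar>angular f u' y\<bar>"
      using W_range[OF assms(1) y] abs_triangle_ineq by (metis abs_mult abs_of_nonneg)
    also have "\<dots> \<le> 1 * ?A + \<bar>W x y - W x' y\<bar> * ?K"
      using W_range[OF assms(1) y] angular_lipschitz[OF assms(3)] angular_bound[OF assms(3)]
      by (intro add_mono mult_mono) auto
    finally show "\<bar>W x y * angular f u y - W x' y * angular f u' y\<bar> \<le> ?A + ?K * \<bar>W x y - W x' y\<bar>"
      by (simp add: mult.commute)
  qed
  also have "\<dots> = ?A + ?K * (LINT y|unit_interval. \<bar>W x y - W x' y\<bar>)" using int by simp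
  finally show ?thesis .
qed

text \<open>The conclusion holds at every point: \<open>J\<close> only integrates its argument, and
  completeness of both measures makes the integrals blind to null sets. So a class in L^1 has one
  definite image function.\<close>

lemma J_cong_AE:
  assumes "AE y in unit_interval. AE v in circle. f (v, y) = g (v, y)"
  shows "J f = J g"
proof
  fix p :: "real \<times> real"
  obtain u x where p: "p = (u, x)" by fastforce
  have "AE y in unit_interval. W x y * angular f u y = W x y * angular g u y"
    using assms
  proof eventually_elim
    case (elim y)
    then have "AE v in circle. even_kernel u v * f (v, y) = even_kernel u v * g (v, y)"
      by eventually_elim simp
    then have "angular f u y = angular g u y"
      unfolding angular_def by (rule circle.integral_cong_AE_complete)
    then show ?case by simp
  qed
  then show "J f p = J g p" unfolding p J_eq by (rule unit_interval.integral_cong_AE_complete)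
qed

text \<open>Both circle integrals for fixed \<open>x\<close> and \<open>y\<close>. This separates
  the Borel part of the double pairing from \<open>W\<close>, which is only Lebesgue measurable, so
  that the two kinds of Fubini argument do not mix.\<close>

definition cross :: "(real \<times> real \<Rightarrow> real) \<Rightarrow> (real \<times> real \<Rightarrow> real) \<Rightarrow> real \<Rightarrow> real \<Rightarrow> real" where
  "cross f g x y = (LINT u|circle. f (u, x) * angular g u y)"

lemma cross_bound:
  assumes "bounded_borel f A" "bounded_borel g B"
  shows "\<bar>cross f g x y\<bar> \<le> 2 * pi * (A * (2 * pi * (kernel_bound * B)))"
proof -
  have "0 \<le> A" using assms(1) order_trans[OF abs_ge_zero] by (auto simp: bounded_borel_def)
  then show ?thesis unfolding cross_def using assms(1) angular_bound[OF assms(2)]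
    by (intro abs_integral_circle_le) (auto simp: abs_mult bounded_borel_def intro!: mult_mono)
qed

lemma cross_measurable:
  assumes "bounded_borel f A" "bounded_borel g B"
    and [measurable]: "a \<in> borel_measurable M" "b \<in> borel_measurable M"
  shows "(\<lambda>p. cross f g (a p) (b p)) \<in> borel_measurable M"
proof -
  note bounded_borel_measurable_pair[OF assms(1), measurable]
    and angular_measurable[OF assms(2), measurable (raw)]
  show ?thesis unfolding cross_def by measurable
qed

lemma integral_circle_J:
  assumes x: "x \<in> {0..1}" and f: "bounded_borel f A" and g: "bounded_borel g B"
  shows "(LINT u|circle. f (u, x) * J g (u, x)) = (LINT y|unit_interval. W x y * cross f g x y)"
proof -
  note bounded_borel_measurable_pair[OF f, measurable]
    and angular_measurable[OF g, measurable (raw)]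
  have [measurable]: "W x \<in> borel_measurable unit_interval" using x by (rule W_section_measurable)
  have "(LINT u|circle. f (u, x) * J g (u, x))
      = (LINT u|circle. LINT y|unit_interval. f (u, x) * (W x y * angular g u y))"
    by (simp add: J_eq)
  also have "\<dots> = (LINT y|unit_interval. LINT u|circle. f (u, x) * (W x y * angular g u y))"
  proof (rule Fubini_bounded)
    show "finite_measure circle" "finite_measure unit_interval" by unfold_locales
    show "(\<lambda>(u, y). f (u, x) * (W x y * angular g u y)) \<in> borel_measurable (circle \<Otimes>\<^sub>M unit_interval)"
      by measurable
    have "0 \<le> A" using f order_trans[OF abs_ge_zero] by (auto simp: bounded_borel_def)
    then show "\<bar>f (u, x) * (W x y * angular g u y)\<bar> \<le> A * (1 * (2 * pi * (kernel_bound * B)))"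
      if "u \<in> space circle" "y \<in> space unit_interval" for u y
      unfolding abs_mult using that W_range[OF x, of y] f angular_bound[OF g]
      by (intro mult_mono) (auto simp: bounded_borel_def)
  qed
  also have "\<dots> = (LINT y|unit_interval. W x y * cross f g x y)"
    by (simp add: cross_def mult.left_commute)
  finally show ?thesis .
qed

lemma cross_sym:
  assumes f: "bounded_borel f A" and g: "bounded_borel g B"
  shows "cross f g x y = cross g f y x"
proof -
  note bounded_borel_measurable_pair[OF f, measurable]
    and bounded_borel_measurable_pair[OF g, measurable]
  have "cross f g x y = (LINT u|circle. LINT v|circle. f (u, x) * (even_kernel u v * g (v, y)))"
    by (simp add: cross_def angular_def)
  also have "\<dots> = (LINT v|circle. LINT u|circle. f (u, x) * (even_kernel u v * g (v, y)))"
  proof (rule Fubini_bounded)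
    show "finite_measure circle" "finite_measure circle" by unfold_locales
    show "(\<lambda>(u, v). f (u, x) * (even_kernel u v * g (v, y))) \<in> borel_measurable (circle \<Otimes>\<^sub>M circle)"
      by measurable
    have "0 \<le> A" using f order_trans[OF abs_ge_zero] by (auto simp: bounded_borel_def)
    then show "\<bar>f (u, x) * (even_kernel u v * g (v, y))\<bar> \<le> A * (kernel_bound * B)" for u v
      unfolding abs_mult using f g even_kernel_bound kernel_bound_nonneg
      by (intro mult_mono) (auto simp: bounded_borel_def)
  qed
  also have "\<dots> = cross g f y x"
  proof -
    have "f (u, x) * (even_kernel u v * g (v, y)) = g (v, y) * (even_kernel v u * f (u, x))" for u v
      using even_kernel_sym[of u v] by simp
    then show ?thesis by (simp only: cross_def angular_def integral_mult_right_zero)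
  qed
  finally show ?thesis .
qed

text \<open>The product of two interval measures is not complete, so \<open>W\<close> need not be
  measurable for it. A Borel function \<open>U\<close>, equal to \<open>W\<close> almost everywhere
  on the square, takes its place; almost all sections agree in either order.\<close>

lemma W_Fubini:
  assumes h: "(\<lambda>(x, y). h x y) \<in> borel_measurable (borel \<Otimes>\<^sub>M borel)" "\<And>x y. \<bar>h x y\<bar> \<le> K"
  shows "(LINT x|unit_interval. LINT y|unit_interval. W x y * h x y)
    = (LINT y|unit_interval. LINT x|unit_interval. W x y * h x y)"
proof -
  let ?S = "{0..1::real} \<times> {0..1::real}"
  have S: "?S \<in> sets lebesgue"
    using lmeasurable_cbox[of "(0::real, 0::real)" "(1, 1)"] by (simp add: cbox_Pair_eq fmeasurableD)
  have "(\<lambda>p. indicator ?S p *\<^sub>R (\<lambda>(x, y). W x y) p) \<in> borel_measurable lebesgue"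
    using W_measurable S by (simp add: borel_measurable_restrict_space_iff)
  from completion_ex_borel_measurable_real[OF this] obtain V where
    V: "V \<in> borel_measurable borel" "AE p in lborel. indicator ?S p *\<^sub>R (\<lambda>(x, y). W x y) p = V p"
    by auto
  \<comment> \<open>Clipping to [0, 1] gives a bound at every point and changes nothing where
    \<open>V\<close> agrees with \<open>W\<close> on the square.\<close>
  define U where "U p = max 0 (min 1 (V p))" for p
  have [measurable]: "U \<in> borel_measurable (borel \<Otimes>\<^sub>M borel)"
    using V(1) unfolding U_def borel_prod by measurable
  have U_bound: "\<bar>U p\<bar> \<le> 1" for p by (simp add: U_def)
  have UW: "AE p in lborel. p \<in> ?S \<longrightarrow> W (fst p) (snd p) = U p"
    using V(2)
  proof eventually_elim
    case (elim p)
    show ?case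
    proof
      assume "p \<in> ?S"
      with elim W_range[of "fst p" "snd p"] show "W (fst p) (snd p) = U p"
        by (auto simp: U_def split_beta)
    qed
  qed
  have eq1: "AE x in unit_interval. AE y in unit_interval. W x y * h x y = U (x, y) * h x y"
  proof (rule AE_lebesgue_on_pair)
    show "AE x in lborel. AE y in lborel. x \<in> {0..1} \<longrightarrow> y \<in> {0..1} \<longrightarrow> W x y * h x y = U (x, y) * h x y"
      using AE_lborel_pair[OF UW]
    proof eventually_elim
      case (elim x)
      then show ?case by eventually_elim auto
    qed
  qed auto
  have eq2: "AE y in unit_interval. AE x in unit_interval. U (x, y) * h x y = W x y * h x y"
  proof (rule AE_lebesgue_on_pair)
    show "AE y in lborel. AE x in lborel. y \<in> {0..1} \<longrightarrow> x \<in> {0..1} \<longrightarrow> U (x, y) * h x y = W x y * h x y"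
      using AE_lborel_pair_swap[OF UW]
    proof eventually_elim
      case (elim x)
      then show ?case by eventually_elim auto
    qed
  qed auto
  have "(LINT x|unit_interval. LINT y|unit_interval. W x y * h x y)
      = (LINT x|unit_interval. LINT y|unit_interval. U (x, y) * h x y)"
  proof (rule unit_interval.integral_cong_AE_complete)
    show "AE x in unit_interval. (LINT y|unit_interval. W x y * h x y) = (LINT y|unit_interval. U (x, y) * h x y)"
      using eq1 by eventually_elim (rule unit_interval.integral_cong_AE_complete)
  qed
  also have "\<dots> = (LINT y|unit_interval. LINT x|unit_interval. U (x, y) * h x y)"
  proof (rule Fubini_bounded)
    show "finite_measure unit_interval" "finite_measure unit_interval" by unfold_locales
    have [measurable]: "(\<lambda>p. h (fst p) (snd p)) \<in> borel_measurable (borel \<Otimes>\<^sub>M borel)"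
      using h(1) by (simp add: split_beta')
    have "(\<lambda>p. U (fst p, snd p) * h (fst p) (snd p)) \<in> borel_measurable (borel \<Otimes>\<^sub>M borel)"
      by measurable
    moreover have "(\<lambda>p. (fst p, snd p)) \<in> unit_interval \<Otimes>\<^sub>M unit_interval \<rightarrow>\<^sub>M borel \<Otimes>\<^sub>M borel"
      by measurable
    ultimately show "(\<lambda>(x, y). U (x, y) * h x y) \<in> borel_measurable (unit_interval \<Otimes>\<^sub>M unit_interval)"
      using measurable_compose by (fastforce simp: split_beta')
    show "\<bar>U (x, y) * h x y\<bar> \<le> 1 * K" for x y
      unfolding abs_mult using U_bound h(2) by (intro mult_mono) auto
  qed
  also have "\<dots> = (LINT y|unit_interval. LINT x|unit_interval. W x y * h x y)"
  proof (rule unit_interval.integral_cong_AE_complete)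
    show "AE y in unit_interval. (LINT x|unit_interval. U (x, y) * h x y) = (LINT x|unit_interval. W x y * h x y)"
      using eq2 by eventually_elim (rule unit_interval.integral_cong_AE_complete)
  qed
  finally show ?thesis .
qed

definition pairing :: "(real \<times> real \<Rightarrow> real) \<Rightarrow> (real \<times> real \<Rightarrow> real) \<Rightarrow> real" where
  "pairing f g = (LINT x|unit_interval. LINT u|circle. f (u, x) * g (u, x))"

text \<open>Self-adjointness of \<open>J\<close>, from the symmetry of \<open>W\<close> and of the
  kernel. It turns an eigenfunction into the left eigenfunctional required by the abstract
  theorem.\<close>

lemma pairing_J:
  assumes f: "bounded_borel f A" and g: "bounded_borel g B"
  shows "pairing f (J g) = pairing g (J f)"
proof -
  have "pairing f (J g) = (LINT x|unit_interval. LINT y|unit_interval. W x y * cross f g x y)"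
    unfolding pairing_def by (rule Bochner_Integration.integral_cong[OF refl]) (use integral_circle_J[OF _ f g] in auto)
  also have "\<dots> = (LINT y|unit_interval. LINT x|unit_interval. W x y * cross f g x y)"
  proof (rule W_Fubini)
    show "(\<lambda>(x, y). cross f g x y) \<in> borel_measurable (borel \<Otimes>\<^sub>M borel)"
      using cross_measurable[OF f g, of fst "borel \<Otimes>\<^sub>M borel" snd] by (simp add: split_beta')
  qed (rule cross_bound[OF f g])
  also have "\<dots> = (LINT y|unit_interval. LINT x|unit_interval. W y x * cross g f y x)"
    by (intro Bochner_Integration.integral_cong refl) (auto simp: W_sym cross_sym[OF f g])
  also have "\<dots> = pairing g (J f)"
    unfolding pairing_def by (rule Bochner_Integration.integral_cong[OF refl]) (use integral_circle_J[OF _ g f] in auto)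
  finally show ?thesis .
qed

section \<open>Relation between the interaction and \<open>J\<close>\<close>

lemma D_eq_Dc: "\<bar>t\<bar> \<le> 2*pi \<Longrightarrow> D t = Dc \<bar>t\<bar>"
  by (cases "t \<ge> 0") (auto simp: Dc_def D_even)

text \<open>Cut the circle at v = u. On the first arc |u - v| = u - v covers (0, u]; on the second,
  evenness and periodicity replace it by u + 2 pi - v, which covers (u, 2 pi]. Together they make
  one period.\<close>

lemma integral_D_shift:
  assumes u: "u \<in> {0..2*pi}"
  shows "(LINT v|circle. Dc \<bar>u - v\<bar>) = (LINT v|circle. Dc v)"
proof -
  \<comment> \<open>With half-open arcs the reflected pieces cover [0, 2 pi) once and the original
    ones (0, 2 pi] once; the missing endpoint is null.\<close>
  define g where "g a b s = indicator {a<..b} s *\<^sub>R Dc s" for a b s :: real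
  have int: "integrable lebesgue (g a b)" for a b
  proof -
    have "integrable (lebesgue_on {a<..b}) Dc"
    proof (rule finite_measure.integrable_const_bound)
      show "finite_measure (lebesgue_on {a<..b})" by (intro finite_measure_lebesgue_on bounded_set_imp_lmeasurable) auto
      show "AE t in lebesgue_on {a<..b}. norm (Dc t) \<le> \<bar>D 0\<bar> + 2 * pi * L" using Dc_bound by simp
    qed (rule borel_measurable_lebesgue_onI[OF Dc_measurable])
    then show ?thesis unfolding g_def by (simp add: integrable_restrict_space)
  qed
  have refl: "(LINT v|lebesgue. g a b (c - v)) = (LINT v|lebesgue. g a b v)"
    "integrable lebesgue (\<lambda>v. g a b (c - v))" for a b c
    using lebesgue_integral_real_affine[of "-1" "g a b" c]
      lebesgue_integrable_real_affine[OF int, of "-1" a b c] by simp_all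
  have ne: "AE v in lebesgue. v \<noteq> c" for c :: real
    by (rule AE_completion, rule AE_lborel_singleton)
  have "(LINT v|circle. Dc \<bar>u - v\<bar>) = (LINT v|lebesgue. indicator {0..2*pi} v *\<^sub>R Dc \<bar>u - v\<bar>)"
    by (simp add: integral_restrict_space)
  also have "\<dots> = (LINT v|lebesgue. g 0 u (u - v) + g u (2*pi) (u + 2*pi - v))"
  proof (rule completion.integral_cong_AE_complete)
    show "AE v in lebesgue. indicator {0..2*pi} v *\<^sub>R Dc \<bar>u - v\<bar> = g 0 u (u - v) + g u (2*pi) (u + 2*pi - v)"
      using ne[of "2*pi"]
    proof eventually_elim
      case (elim v)
      have "Dc (u + 2*pi - v) = Dc \<bar>u - v\<bar>" if "u \<le> v" "v \<le> 2*pi"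
      proof -
        have "Dc (u + 2*pi - v) = D (u - v + 2*pi)" using u that by (simp add: Dc_def algebra_simps)
        then show ?thesis using D_eq_Dc[of "u - v"] u that by (simp add: D_periodic)
      qed
      then show ?case using elim u by (auto simp: g_def indicator_def)
    qed
  qed
  also have "\<dots> = (LINT v|lebesgue. g 0 u v) + (LINT v|lebesgue. g u (2*pi) v)"
    by (simp add: refl)
  also have "\<dots> = (LINT v|lebesgue. g 0 u v + g u (2*pi) v)" by (simp add: int)
  also have "\<dots> = (LINT v|lebesgue. indicator {0..2*pi} v *\<^sub>R Dc v)"
  proof (rule completion.integral_cong_AE_complete)
    show "AE v in lebesgue. g 0 u v + g u (2*pi) v = indicator {0..2*pi} v *\<^sub>R Dc v"
      using ne[of 0] by eventually_elim (use u in \<open>auto simp: g_def indicator_def\<close>)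
  qed
  also have "\<dots> = (LINT v|circle. Dc v)" by (simp add: integral_restrict_space)
  finally show ?thesis .
qed

lemma Dc_integrable:
  assumes "integrable circle F" "g \<in> borel_measurable borel"
  shows "integrable circle (\<lambda>v. Dc (g v) * F v)"
proof (rule Bochner_Integration.integrable_bound)
  show "integrable circle (\<lambda>v. (\<bar>D 0\<bar> + 2 * pi * L) * F v)" using assms(1) by simp
  show "(\<lambda>v. Dc (g v) * F v) \<in> borel_measurable circle"
    using borel_measurable_lebesgue_onI[OF measurable_compose[OF assms(2) Dc_measurable]]
      borel_measurable_integrable[OF assms(1)] by (rule borel_measurable_times)
  show "AE v in circle. norm (Dc (g v) * F v) \<le> norm ((\<bar>D 0\<bar> + 2 * pi * L) * F v)"
    using Dc_bound L_nonneg by (auto simp: abs_mult intro!: mult_right_mono)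
qed

text \<open>Reflecting v turns u - v into u + v - 2 pi up to a period and preserves an even
  \<open>F\<close>, so \<open>D\<close> may be averaged over both. The subtracted mean reappears as
  a multiple of the mass of \<open>F\<close>.\<close>

lemma integral_D_even:
  assumes u: "u \<in> {0..2*pi}" and F: "integrable circle F"
    and even: "AE v in circle. F (2*pi - v) = F v"
  shows "(LINT v|circle. D (u - v) * F v)
    = (LINT v|circle. even_kernel u v * F v) + D_mean * (LINT v|circle. F v)"
proof -
  have 1: "(LINT v|circle. D (u - v) * F v) = (LINT v|circle. Dc \<bar>u - v\<bar> * F v)"
    using u D_eq_Dc by (intro Bochner_Integration.integral_cong) auto
  have "(LINT v|circle. Dc \<bar>u - v\<bar> * F v) = (LINT v|circle. Dc \<bar>u - (2*pi - v)\<bar> * F (2*pi - v))"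
    by (rule integral_circle_reflect[symmetric])
  also have "\<dots> = (LINT v|circle. Dc \<bar>u + v - 2*pi\<bar> * F v)"
  proof (rule circle.integral_cong_AE_complete)
    show "AE v in circle. Dc \<bar>u - (2*pi - v)\<bar> * F (2*pi - v) = Dc \<bar>u + v - 2*pi\<bar> * F v"
      using even by eventually_elim (simp add: algebra_simps)
  qed
  finally have 2: "(LINT v|circle. Dc \<bar>u - v\<bar> * F v) = (LINT v|circle. Dc \<bar>u + v - 2*pi\<bar> * F v)" .
  have "(LINT v|circle. even_kernel u v * F v)
    = (LINT v|circle. (Dc \<bar>u - v\<bar> * F v + Dc \<bar>u + v - 2*pi\<bar> * F v) / 2 - D_mean * F v)"
    by (rule Bochner_Integration.integral_cong) (simp_all add: even_kernel_def field_simps)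
  also have "\<dots> = ((LINT v|circle. Dc \<bar>u - v\<bar> * F v) + (LINT v|circle. Dc \<bar>u + v - 2*pi\<bar> * F v)) / 2
      - D_mean * (LINT v|circle. F v)"
    using F Dc_integrable[OF F, of "\<lambda>v. \<bar>u - v\<bar>"] Dc_integrable[OF F, of "\<lambda>v. \<bar>u + v - 2*pi\<bar>"]
    by simp
  finally show ?thesis using 1 2 by simp
qed

lemma integral_even_kernel: "u \<in> {0..2*pi} \<Longrightarrow> (LINT v|circle. even_kernel u v) = 0"
proof -
  assume u: "u \<in> {0..2*pi}"
  then have "(LINT v|circle. D (u - v)) = (LINT v|circle. Dc \<bar>u - v\<bar>)"
    using D_eq_Dc by (intro Bochner_Integration.integral_cong) auto
  then show ?thesis
    using integral_D_even[OF u, of "\<lambda>_. 1"] integral_D_shift[OF u] by (simp add: D_mean_def)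
qed

lemma angular_constant: "u \<in> {0..2*pi} \<Longrightarrow> angular (\<lambda>p. c (snd p)) u y = 0"
  by (simp add: angular_def integral_even_kernel)

lemma J_constant: "fst p \<in> {0..2*pi} \<Longrightarrow> J (\<lambda>p. c (snd p)) p = 0"
  by (cases p) (simp add: J_eq angular_constant)

lemma J_even: "J f (2*pi - u, x) = J f (u, x)"
  by (simp add: J_def even_kernel_reflect)

text \<open>By symmetry the integration in u moves to the kernel acting on the constant 1, where it
  gives 0.\<close>

lemma J_mean_zero:
  assumes "x \<in> {0..1}" "bounded_borel f B"
  shows "(LINT u|circle. J f (u, x)) = 0"
proof -
  have one: "bounded_borel (\<lambda>_::real \<times> real. 1) 1" by (simp add: bounded_borel_def)
  have "cross (\<lambda>_. 1) f x y = 0" for y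
  proof -
    have "cross (\<lambda>_. 1) f x y = cross f (\<lambda>_. 1) y x" by (rule cross_sym[OF one assms(2)])
    also have "\<dots> = (LINT u|circle. 0)"
      unfolding cross_def using angular_constant[of _ "\<lambda>_. 1"]
      by (intro Bochner_Integration.integral_cong) auto
    finally show ?thesis by simp
  qed
  then show ?thesis using integral_circle_J[OF assms(1) one assms(2)] by simp
qed

text \<open>As \<open>c\<close> does not depend on \<open>y\<close>, the term with
  \<open>D_mean\<close> contributes a function of \<open>x\<close> alone. Hypotheses on almost every
  section cover integrable eigenfunctions and explicit densities alike.\<close>

lemma interaction_eq:
  assumes u: "u \<in> {0..2*pi}"
    and f: "AE y in unit_interval. integrable circle (\<lambda>v. f (v, y))"
      "AE y in unit_interval. AE v in circle. f (2*pi - v, y) = f (v, y)"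
      "AE y in unit_interval. (LINT v|circle. f (v, y)) = c"
  shows "interaction W D f (u, x) = (LINT y|unit_interval. W x y * (angular f u y + D_mean * c))"
proof -
  have "interaction W D f (u, x) = (LINT y|unit_interval. W x y * (LINT v|circle. D (u - v) * f (v, y)))"
    by (simp add: interaction_def mult.assoc)
  also have "\<dots> = (LINT y|unit_interval. W x y * (angular f u y + D_mean * c))"
  proof (rule unit_interval.integral_cong_AE_complete)
    show "AE y in unit_interval. W x y * (LINT v|circle. D (u - v) * f (v, y))
        = W x y * (angular f u y + D_mean * c)"
      using f
    proof eventually_elim
      case (elim y)
      show ?case using integral_D_even[OF u elim(1,2)] elim(3) by (simp add: angular_def)
    qed
  qed
  finally show ?thesis .
qed

lemma interaction_eq_J:
  assumes u: "u \<in> {0..2*pi}"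
    and f: "AE y in unit_interval. integrable circle (\<lambda>v. f (v, y))"
      "AE y in unit_interval. AE v in circle. f (2*pi - v, y) = f (v, y)"
      "AE y in unit_interval. (LINT v|circle. f (v, y)) = 0"
  shows "interaction W D f (u, x) = J f (u, x)"
  using interaction_eq[OF u f] by (simp add: J_eq)

lemma interaction_eq_J_plus:
  assumes u: "u \<in> {0..2*pi}" and x: "x \<in> {0..1}" and B: "bounded_borel f B"
    and f: "\<And>v y. v \<in> {0..2*pi} \<Longrightarrow> y \<in> {0..1} \<Longrightarrow> f (2*pi - v, y) = f (v, y)"
      "\<And>y. y \<in> {0..1} \<Longrightarrow> (LINT v|circle. f (v, y)) = c"
  shows "interaction W D f (u, x) = J f (u, x) + (LINT y|unit_interval. W x y * (D_mean * c))"
proof -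
  have "integrable circle (\<lambda>v. f (v, y))" for y
    using bounded_borel_section[OF B, of y] borel_measurable_lebesgue_onI
    by (intro circle.integrable_const_bound[where B=B]) (auto simp: bounded_borel_def)
  then have "interaction W D f (u, x) = (LINT y|unit_interval. W x y * (angular f u y + D_mean * c))"
    using f by (intro interaction_eq[OF u] AE_I2) auto
  also have "\<dots> = J f (u, x) + (LINT y|unit_interval. W x y * (D_mean * c))"
    using W_angular_integrable[OF x B, of u] W_integrable[OF x, of "\<lambda>_. D_mean * c" "\<bar>D_mean * c\<bar>"]
    unfolding J_eq distrib_left by (intro Bochner_Integration.integral_add) auto
  finally show ?thesis .
qed

end

section \<open>The interaction on bounded continuous functions\<close>

text \<open>Retraction of the plane onto the cylinder; composing with it represents functions on the
  cylinder by bounded continuous functions on the plane.\<close>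

definition cylinder_clamp :: "real \<times> real \<Rightarrow> real \<times> real" where
  "cylinder_clamp p = (max 0 (min (fst p) (2*pi)), max 0 (min (snd p) 1))"

lemma cylinder_clamp_in [simp]:
  "0 \<le> fst (cylinder_clamp p)" "fst (cylinder_clamp p) \<le> 2*pi"
  "0 \<le> snd (cylinder_clamp p)" "snd (cylinder_clamp p) \<le> 1"
  by (auto simp: cylinder_clamp_def)

lemma cylinder_clamp_id [simp]: "u \<in> {0..2*pi} \<Longrightarrow> x \<in> {0..1} \<Longrightarrow> cylinder_clamp (u, x) = (u, x)"
  by (auto simp: cylinder_clamp_def)

lemma cylinder_clamp_idem [simp]: "cylinder_clamp (cylinder_clamp p) = cylinder_clamp p"
  by (auto simp: cylinder_clamp_def)

lemma cylinder_clamp_dist: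
  "\<bar>fst (cylinder_clamp p) - fst (cylinder_clamp q)\<bar> \<le> dist p q"
  "\<bar>snd (cylinder_clamp p) - snd (cylinder_clamp q)\<bar> \<le> dist p q"
  using dist_fst_le[of p q] dist_snd_le[of p q] by (auto simp: cylinder_clamp_def dist_real_def)

context interaction_kernel
begin

text \<open>Since \<delta> depends on \<open>B\<close> but not on \<open>f\<close>, this gives both
  the continuity of a single image and the hypothesis of Arzela-Ascoli.\<close>

lemma J_equicontinuous:
  assumes "\<epsilon> > 0" "B \<ge> 0"
  obtains \<delta> where "\<delta> > 0" "\<And>(f :: real \<times> real \<Rightarrow> real) p q. bounded_borel f B \<Longrightarrow> dist p q < \<delta> \<Longrightarrow>
    \<bar>J f (cylinder_clamp p) - J f (cylinder_clamp q)\<bar> < \<epsilon>"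
proof -
  define K where "K = 2 * pi * (kernel_bound * B)"
  define A where "A = 2 * pi * (L * B)"
  have K: "K \<ge> 0" and A: "A \<ge> 0" using kernel_bound_nonneg L_nonneg assms(2) by (auto simp: K_def A_def)
  obtain \<delta>\<^sub>1 where \<delta>\<^sub>1: "\<delta>\<^sub>1 > 0" "\<And>x x'. x \<in> {0..1} \<Longrightarrow> x' \<in> {0..1} \<Longrightarrow> \<bar>x - x'\<bar> < \<delta>\<^sub>1 \<Longrightarrow>
      (LINT y|unit_interval. \<bar>W x y - W x' y\<bar>) < \<epsilon> / (2 * (K + 1))"
    using W_continuous[of "\<epsilon> / (2 * (K + 1))"] assms(1) K by auto
  define \<delta> where "\<delta> = min \<delta>\<^sub>1 (\<epsilon> / (2 * (A + 1)))"
  show thesis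
  proof (rule that)
    show "\<delta> > 0" using \<delta>\<^sub>1 assms(1) A by (simp add: \<delta>_def)
    fix f :: "real \<times> real \<Rightarrow> real" and p q :: "real \<times> real"
    assume f: "bounded_borel f B" and pq: "dist p q < \<delta>"
    obtain u x where p: "cylinder_clamp p = (u, x)" by fastforce
    obtain u' x' where q: "cylinder_clamp q = (u', x')" by fastforce
    have xx: "x \<in> {0..1}" "x' \<in> {0..1}" using cylinder_clamp_in(3,4)[of p] cylinder_clamp_in(3,4)[of q] p q by simp_all
    have ux: "\<bar>u - u'\<bar> \<le> dist p q" "\<bar>x - x'\<bar> \<le> dist p q"
      using cylinder_clamp_dist[of p q] p q by auto
    have "\<bar>J f (u, x) - J f (u', x')\<bar> \<le> A * \<bar>u - u'\<bar> + K * (LINT y|unit_interval. \<bar>W x y - W x' y\<bar>)"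
      using J_diff_bound[OF xx f] by (simp add: A_def K_def mult_ac)
    \<comment> \<open>The added 1 avoids division by zero and, as A / (A + 1) < 1, makes each half
      strictly smaller than \<epsilon> / 2.\<close>
    also have "\<dots> \<le> A * (\<epsilon> / (2 * (A + 1))) + K * (\<epsilon> / (2 * (K + 1)))"
      using \<delta>\<^sub>1(2)[OF xx] ux pq A K by (intro add_mono mult_left_mono) (auto simp: \<delta>_def)
    also have "\<dots> < \<epsilon> / 2 + \<epsilon> / 2"
      using assms(1) A K by (intro add_strict_mono) (auto simp: field_simps)
    finally show "\<bar>J f (cylinder_clamp p) - J f (cylinder_clamp q)\<bar> < \<epsilon>" by (simp add: p q)
  qed
qed

text \<open>Values off the cylinder are copied from its boundary. Hence an eigenvector of
  \<open>JC\<close> for a nonzero eigenvalue is determined by its values on the cylinder, and the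
  rest of the plane adds no spurious ones.\<close>

definition JC :: "(real \<times> real \<Rightarrow> real) \<Rightarrow> (real \<times> real) \<Rightarrow>\<^sub>C real" where
  "JC f = Bcontfun (\<lambda>p. J f (cylinder_clamp p))"

lemma JC_apply:
  assumes f: "bounded_borel f B"
  shows "apply_bcontfun (JC f) p = J f (cylinder_clamp p)"
proof -
  have "continuous_on UNIV (\<lambda>p. J f (cylinder_clamp p))"
    unfolding continuous_on_iff
  proof (intro ballI allI impI)
    fix p :: "real \<times> real" and e :: real assume "e > 0"
    then obtain \<delta> where "\<delta> > 0" "\<And>g p q. bounded_borel g B \<Longrightarrow> dist p q < \<delta> \<Longrightarrow>
        \<bar>J g (cylinder_clamp p) - J g (cylinder_clamp q)\<bar> < e"
      using J_equicontinuous bounded_borel_nonneg[OF f] by metis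
    then show "\<exists>d>0. \<forall>q\<in>UNIV. dist q p < d \<longrightarrow> dist (J f (cylinder_clamp q)) (J f (cylinder_clamp p)) < e"
      unfolding dist_real_def using f by blast
  qed
  moreover have "norm (J f (cylinder_clamp p)) \<le> 2 * pi * (kernel_bound * B)" for p
    using J_bound[OF _ f] by simp
  ultimately have "(\<lambda>p. J f (cylinder_clamp p)) \<in> bcontfun" by (rule bcontfun_normI)
  then show ?thesis by (simp add: JC_def Bcontfun_inverse)
qed

lemma JC_norm: "bounded_borel f B \<Longrightarrow> norm (JC f) \<le> 2 * pi * (kernel_bound * B)"
  by (rule norm_bound) (simp add: JC_apply J_bound)

lemma JC_add:
  assumes "bounded_borel f A" "bounded_borel g B"
  shows "JC (\<lambda>p. f p + g p) = JC f + JC g"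
  by (intro bcontfun_eqI)
    (simp add: JC_apply[OF bounded_borel_add[OF assms]] JC_apply[OF assms(1)] JC_apply[OF assms(2)] J_add[OF _ assms])

lemma JC_scale: "bounded_borel f A \<Longrightarrow> JC (\<lambda>p. c * f p) = c *\<^sub>R JC f"
  by (intro bcontfun_eqI) (simp add: JC_apply[OF bounded_borel_scale] JC_apply J_scale)

lemma JC_diff: 
  assumes "bounded_borel f A" "bounded_borel g B"
  shows "JC f - JC g = JC (\<lambda>p. f p - g p)"
  using JC_add[OF assms(1) bounded_borel_scale[OF assms(2), of "-1"]] JC_scale[OF assms(2), of "-1"] by simp

lemma JC_bounded_linear: "bounded_linear (\<lambda>h. JC (apply_bcontfun h))"
proof (rule bounded_linear_intro)
  show "JC (apply_bcontfun (x + y)) = JC (apply_bcontfun x) + JC (apply_bcontfun y)" for x y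
    using JC_add[OF bounded_borel_bcontfun bounded_borel_bcontfun] by simp
  show "JC (apply_bcontfun (r *\<^sub>R x)) = r *\<^sub>R JC (apply_bcontfun x)" for r x
    using JC_scale[OF bounded_borel_bcontfun] by simp
  show "norm (JC (apply_bcontfun x)) \<le> norm x * (2 * pi * kernel_bound)" for x
    using JC_norm[OF bounded_borel_bcontfun, of x] by (simp add: mult_ac)
qed

text \<open>Arzela-Ascoli on the closed rectangle. Images factor through
  \<open>cylinder_clamp\<close>, so uniform convergence there makes the sequence Cauchy in norm, and
  completeness supplies the limit.\<close>

lemma JC_compact: "compact_map (\<lambda>h. JC (apply_bcontfun h))"
  unfolding compact_map_def
proof (intro allI impI)
  fix h :: "nat \<Rightarrow> (real \<times> real) \<Rightarrow>\<^sub>C real" assume "bounded (range h)"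
  then obtain B where hB: "\<And>n. norm (h n) \<le> B" by (auto simp: bounded_iff)
  have B: "B \<ge> 0" using hB[of 0] norm_ge_zero order_trans by blast
  have bb: "bounded_borel (apply_bcontfun (h n)) B" for n
    using bounded_borel_bcontfun hB by (rule bounded_borel_mono)
  let ?S = "cbox (0::real, 0::real) (2*pi, 1)"
  let ?F = "\<lambda>n p. J (apply_bcontfun (h n)) (cylinder_clamp p)"
  obtain g r where r: "strict_mono (r :: nat \<Rightarrow> nat)"
    and g: "\<And>e. 0 < e \<Longrightarrow> \<exists>N. \<forall>n x. n \<ge> N \<and> x \<in> ?S \<longrightarrow> norm (?F (r n) x - g x) < e"
  proof (rule Arzela_Ascoli[of ?S ?F "2 * pi * (kernel_bound * B)"])
    show "norm (?F n p) \<le> 2 * pi * (kernel_bound * B)" for n p using J_bound[OF _ bb] by simp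
    show "\<exists>d>0. \<forall>n q. q \<in> ?S \<and> norm (p - q) < d \<longrightarrow> norm (?F n p - ?F n q) < e" if e: "e > 0" for p e
    proof -
      obtain \<delta> where "\<delta> > 0" "\<And>g p q. bounded_borel g B \<Longrightarrow> dist p q < \<delta> \<Longrightarrow>
          \<bar>J g (cylinder_clamp p) - J g (cylinder_clamp q)\<bar> < e"
        using J_equicontinuous[OF e B] by metis
      then have "\<forall>n q. norm (p - q) < \<delta> \<longrightarrow> norm (?F n p - ?F n q) < e"
        unfolding dist_norm real_norm_def using bb by blast
      then show ?thesis using \<open>\<delta> > 0\<close> by blast
    qed
  qed auto
  have "Cauchy (\<lambda>n. JC (apply_bcontfun (h (r n))))"
  proof (rule CauchyI)
    fix e :: real assume e: "e > 0"
    then have "e / 4 > 0" by simp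
    from g[OF this] obtain N
      where N: "\<And>n p. n \<ge> N \<Longrightarrow> p \<in> ?S \<Longrightarrow> norm (?F (r n) p - g p) < e / 4" by blast
    have "norm (JC (apply_bcontfun (h (r i))) - JC (apply_bcontfun (h (r j)))) < e" if ij: "i \<ge> N" "j \<ge> N" for i j
    proof -
      have "norm (apply_bcontfun (JC (apply_bcontfun (h (r i))) - JC (apply_bcontfun (h (r j)))) p) \<le> e / 2" for p
      proof -
        have "cylinder_clamp p \<in> ?S" using cylinder_clamp_in[of p] by (cases "cylinder_clamp p") (auto simp: cbox_Pair_eq)
        then have "\<bar>?F (r i) p - g (cylinder_clamp p)\<bar> < e / 4" "\<bar>?F (r j) p - g (cylinder_clamp p)\<bar> < e / 4"
          using N[of i "cylinder_clamp p"] N[of j "cylinder_clamp p"] ij by auto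
        then have "\<bar>?F (r i) p - ?F (r j) p\<bar> \<le> e / 2" by arith
        then show ?thesis by (simp add: JC_apply[OF bb])
      qed
      then have "norm (JC (apply_bcontfun (h (r i))) - JC (apply_bcontfun (h (r j)))) \<le> e / 2"
        by (rule norm_bound)
      then show ?thesis using e by linarith
    qed
    then show "\<exists>M. \<forall>i\<ge>M. \<forall>j\<ge>M. norm (JC (apply_bcontfun (h (r i))) - JC (apply_bcontfun (h (r j)))) < e"
      by blast
  qed
  then show "\<exists>r y. strict_mono r \<and> (\<lambda>n. JC (apply_bcontfun (h (r n)))) \<longlonglongrightarrow> y"
    using r by (auto simp: Cauchy_convergent_iff convergent_def)
qed

end

section \<open>Estimates for exponentials and their quotients\<close>

lemma abs_exp_remainder_le:
  fixes s t r :: real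
  assumes "\<bar>s\<bar> \<le> r" "\<bar>t\<bar> \<le> r"
  shows "\<bar>exp s - exp t - (s - t)\<bar> \<le> (exp r - 1) * \<bar>s - t\<bar>"
proof -
  have "norm ((exp s - s) - (exp t - t)) \<le> (exp r - 1) * norm (s - t)"
  \<comment> \<open>Mean value bound for exp x - x. Its derivative has modulus at most exp r - 1 on
    the interval; for negative z this uses 1 - exp z \<le> - z \<le> r \<le> exp r - 1.\<close>
  proof (rule field_differentiable_bound[of "{-r..r}" "\<lambda>x. exp x - x" "\<lambda>x. exp x - 1"])
    show "((\<lambda>x. exp x - x) has_field_derivative exp z - 1) (at z within {-r..r})" for z :: real
      by (auto intro!: derivative_eq_intros)
    show "norm (exp z - 1) \<le> exp r - 1" if "z \<in> {-r..r}" for z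
    proof (cases "z \<ge> 0")
      case True then show ?thesis using that by simp
    next
      case False
      then have "1 - exp z \<le> - z" using exp_ge_add_one_self[of z] by linarith
      moreover have "r \<le> exp r - 1" using exp_ge_add_one_self[of r] by linarith
      ultimately show ?thesis using that False by auto
    qed
  qed (use assms in auto)
  then show ?thesis by (simp add: algebra_simps)
qed

lemma abs_minus_one_le_exp:
  fixes y t :: real
  assumes "exp (- t) \<le> y" "y \<le> exp t"
  shows "\<bar>y - 1\<bar> \<le> exp t - 1"
proof -
  have "1 - t \<le> exp (- t)" "1 + t \<le> exp t" using exp_ge_add_one_self[of t] exp_ge_add_one_self[of "- t"] by simp_all
  then show ?thesis using assms by (intro abs_leI) linarith+
qed

text \<open>Here \<open>d\<close> and \<open>m\<close> are the first-order parts of E - E' and a -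
  b, and \<open>E'\<close>, \<open>a\<close>, \<open>b\<close> are close to 1. To first order E / a
  - E' / b is then d - m.\<close>

lemma quotient_remainder_le:
  fixes r :: real
  assumes r: "r \<ge> 0" and \<delta>: "\<delta> \<ge> 0"
    and E: "exp (- r) \<le> E'" "E' \<le> exp r" and a: "exp (- r) \<le> a" "a \<le> exp r" and b: "exp (- r) \<le> b" "b \<le> exp r"
    and d: "\<bar>E - E' - d\<bar> \<le> (exp r - 1) * \<delta>" "\<bar>d\<bar> \<le> \<delta>"
    and m: "\<bar>a - b - m\<bar> \<le> (exp r - 1) * \<delta>" "\<bar>m\<bar> \<le> \<delta>"
  shows "\<bar>E / a - E' / b - d + m\<bar> \<le> 4 * (exp (3 * r) - 1) * exp (3 * r) * \<delta>"
proof -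
  have pos: "a > 0" "b > 0" "E' > 0" using E a b exp_gt_zero[of "- r"] by linarith+
  have inv: "exp (- r) \<le> 1 / c \<and> 1 / c \<le> exp r" if "exp (- r) \<le> c" "c \<le> exp r" for c
  proof -
    have "c > 0" using that(1) exp_gt_zero[of "- r"] by linarith
    then show ?thesis using that by (simp add: exp_minus field_simps)
  qed
  \<comment> \<open>A product of three factors between exp (- r) and exp r, which is the origin of 3
    r.\<close>
  define q where "q = E' * (1 / a) * (1 / b)"
  have q: "exp (- (3 * r)) \<le> q" "q \<le> exp (3 * r)"
  proof -
    have "exp (- r) * exp (- r) * exp (- r) \<le> q" "q \<le> exp r * exp r * exp r"
      unfolding q_def using E pos inv[OF a] inv[OF b] by (intro mult_mono; simp)+
    then show "exp (- (3 * r)) \<le> q" "q \<le> exp (3 * r)" by (simp_all flip: exp_add)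
  qed
  have r3: "exp r \<le> exp (3 * r)" "1 \<le> exp (3 * r)" "1 \<le> exp r" using r by auto
  have a1: "\<bar>1 / a\<bar> \<le> exp (3 * r)" 
  proof -
    have "1 / a \<le> exp (3 * r)" using inv[OF a] r3(1) by linarith
    then show ?thesis using pos by simp
  qed
  have a2: "\<bar>1 / a - 1\<bar> \<le> exp (3 * r) - 1"
    using abs_minus_one_le_exp[of r "1 / a"] inv[OF a] r3 by linarith
  have q1: "\<bar>q\<bar> \<le> exp (3 * r)" using q exp_gt_zero[of "- (3 * r)"] by linarith
  have q2: "\<bar>q - 1\<bar> \<le> exp (3 * r) - 1" using abs_minus_one_le_exp[OF q] .
  have d1: "\<bar>E - E' - d\<bar> \<le> (exp (3 * r) - 1) * \<delta>"
    using d(1) mult_right_mono[OF _ \<delta>, of "exp r - 1" "exp (3 * r) - 1"] r3 by linarith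
  have m1: "\<bar>a - b - m\<bar> \<le> (exp (3 * r) - 1) * \<delta>"
    using m(1) mult_right_mono[OF _ \<delta>, of "exp r - 1" "exp (3 * r) - 1"] r3 by linarith
  let ?M = "(exp (3 * r) - 1) * exp (3 * r) * \<delta>"
  have M: "(exp (3 * r) - 1) * \<delta> \<le> ?M"
  proof -
    have "(exp (3 * r) - 1) * 1 \<le> (exp (3 * r) - 1) * exp (3 * r)" using r3 by (intro mult_left_mono) auto
    then show ?thesis using mult_right_mono[OF _ \<delta>] by fastforce
  qed
  \<comment> \<open>Each of the four terms is a bounded multiple of a remainder, or a first-order
    change times a deviation from 1; hence the factor 4.\<close>
  have "E / a - E' / b - d + m
    = (E - E' - d) * (1 / a) + d * (1 / a - 1) - (a - b - m) * q - m * (q - 1)"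
    using pos by (simp add: q_def field_simps)
  moreover have "\<bar>(E - E' - d) * (1 / a)\<bar> \<le> ?M"
    using mult_mono[OF d1 a1] r3 \<delta> by (simp add: abs_mult mult_ac)
  moreover have "\<bar>d * (1 / a - 1)\<bar> \<le> ?M"
    using mult_mono[OF d(2) a2 \<delta>] M unfolding abs_mult by (simp add: mult_ac)
  moreover have "\<bar>(a - b - m) * q\<bar> \<le> ?M"
    using mult_mono[OF m1 q1] r3 \<delta> by (simp add: abs_mult mult_ac)
  moreover have "\<bar>m * (q - 1)\<bar> \<le> ?M"
    using mult_mono[OF m(2) q2 \<delta>] M unfolding abs_mult by (simp add: mult_ac)
  ultimately have "\<bar>E / a - E' / b - d + m\<bar> \<le> 4 * ?M" by arith
  then show ?thesis by (simp only: mult.assoc)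
qed

section \<open>The normalised exponential\<close>

lemma bounded_borel_integrable_circle:
  fixes g :: "real \<times> real \<Rightarrow> real"
  assumes "bounded_borel g B"
  shows "integrable circle (\<lambda>u. g (u, x))"
proof (rule circle.integrable_const_bound)
  have "(\<lambda>u. g (u, x)) \<in> borel_measurable borel"
    using bounded_borel_section[OF assms] by (simp add: bounded_borel_def)
  then show "(\<lambda>u. g (u, x)) \<in> borel_measurable circle" by (rule borel_measurable_lebesgue_onI)
  show "AE u in circle. norm (g (u, x)) \<le> B" using assms by (simp add: bounded_borel_def)
qed

definition circle_mean :: "(real \<times> real \<Rightarrow> real) \<Rightarrow> real \<Rightarrow> real" where
  "circle_mean g x = (LINT u|circle. g (u, x)) / (2*pi)"

lemma circle_mean_measurable:
  assumes "bounded_borel g B"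
  shows "(\<lambda>p. circle_mean g (snd p)) \<in> borel_measurable (borel :: (real \<times> real) measure)"
proof -
  note bounded_borel_measurable_pair[OF assms, measurable]
  have "(\<lambda>x. circle_mean g x) \<in> borel_measurable borel"
    unfolding circle_mean_def by measurable
  then have "(\<lambda>p. circle_mean g (snd p)) \<in> borel_measurable ((borel :: real measure) \<Otimes>\<^sub>M borel)"
    by measurable
  then show ?thesis by (simp only: borel_prod)
qed

lemma circle_mean_bounds:
  assumes "bounded_borel g B" "\<And>p. a \<le> g p" "\<And>p. g p \<le> b"
  shows "a \<le> circle_mean g x" "circle_mean g x \<le> b"
proof -
  note int = bounded_borel_integrable_circle[OF assms(1), of x]
  have "(LINT u|circle. a) \<le> (LINT u|circle. g (u, x))" "(LINT u|circle. g (u, x)) \<le> (LINT u|circle. b)"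
    using assms(2,3) by (intro integral_mono int; simp)+
  moreover have "(LINT u|circle. c) = c * (2*pi)" for c by simp
  ultimately have "a * (2*pi) \<le> (LINT u|circle. g (u, x))" "(LINT u|circle. g (u, x)) \<le> b * (2*pi)"
    by (simp_all add: mult.commute[of "2*pi"])
  then show "a \<le> circle_mean g x" "circle_mean g x \<le> b"
    by (simp_all only: circle_mean_def pos_le_divide_eq pos_divide_le_eq pi_gt_zero mult_pos_pos zero_less_numeral)
qed

lemma circle_mean_abs:
  assumes "\<And>p. \<bar>g p\<bar> \<le> B"
  shows "\<bar>circle_mean g x\<bar> \<le> B"
  using abs_integral_circle_le[of "\<lambda>u. g (u, x)" B] assms
  by (simp add: circle_mean_def field_simps)

lemma circle_mean_diff:
  assumes "bounded_borel f A" "bounded_borel g B"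
  shows "circle_mean f x - circle_mean g x = circle_mean (\<lambda>p. f p - g p) x"
  using bounded_borel_integrable_circle[OF assms(1), of x] bounded_borel_integrable_circle[OF assms(2), of x]
  by (simp add: circle_mean_def diff_divide_distrib)

lemma bounded_borel_exp:
  assumes "bounded_borel h r"
  shows "bounded_borel (\<lambda>p. exp (h p)) (exp r)"
  using assms by (auto simp: bounded_borel_def abs_le_iff)

lemma exp_bounds:
  assumes "bounded_borel h r"
  shows "exp (- r) \<le> exp (h p)" "exp (h p) \<le> exp r"
proof -
  have "\<bar>h p\<bar> \<le> r" using assms by (simp add: bounded_borel_def)
  then show "exp (- r) \<le> exp (h p)" "exp (h p) \<le> exp r" by auto
qed

lemma circle_mean_exp_bounds:
  assumes "bounded_borel h r"
  shows "exp (- r) \<le> circle_mean (\<lambda>p. exp (h p)) x" "circle_mean (\<lambda>p. exp (h p)) x \<le> exp r"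
  using circle_mean_bounds[OF bounded_borel_exp[OF assms] exp_bounds[OF assms]] by auto

definition gibbs :: "(real \<times> real \<Rightarrow> real) \<Rightarrow> real \<times> real \<Rightarrow> real" where
  "gibbs h p = exp (h p) / (LINT u|circle. exp (h (u, snd p)))"

text \<open>With the mean in place of the integral, numerator and denominator both lie between exp
  (- r) and exp r when \<open>h\<close> is bounded by r, as \<open>quotient_remainder_le\<close>
  expects.\<close>

lemma gibbs_eq: "2 * pi * gibbs h p = exp (h p) / circle_mean (\<lambda>p. exp (h p)) (snd p)"
  by (simp add: gibbs_def circle_mean_def)

lemma gibbs_bounds:
  assumes "bounded_borel h r"
  shows "exp (- (2 * r)) \<le> 2 * pi * gibbs h p" "2 * pi * gibbs h p \<le> exp (2 * r)"
proof -
  let ?a = "circle_mean (\<lambda>p. exp (h p)) (snd p)"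
  have a: "exp (- r) \<le> ?a" "?a \<le> exp r" by (rule circle_mean_exp_bounds[OF assms])+
  then have "?a > 0" using exp_gt_zero[of "- r"] by linarith
  have "exp (- (2 * r)) * ?a \<le> exp (- (2 * r)) * exp r" using a by (intro mult_left_mono) auto
  also have "\<dots> = exp (- r)" by (simp flip: exp_add)
  finally have "exp (- (2 * r)) * ?a \<le> exp (h p)" using exp_bounds[OF assms, of p] by linarith
  then show "exp (- (2 * r)) \<le> 2 * pi * gibbs h p"
    using \<open>?a > 0\<close> by (simp only: gibbs_eq pos_le_divide_eq)
  have "exp r = exp (2 * r) * exp (- r)" by (simp flip: exp_add)
  also have "\<dots> \<le> exp (2 * r) * ?a" using a by (intro mult_left_mono) auto
  finally have "exp (h p) \<le> exp (2 * r) * ?a" using exp_bounds[OF assms, of p] by linarith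
  then show "2 * pi * gibbs h p \<le> exp (2 * r)"
    using \<open>?a > 0\<close> by (simp only: gibbs_eq pos_divide_le_eq)
qed

lemma gibbs_nonneg: "0 \<le> gibbs h p"
  unfolding gibbs_def by (intro divide_nonneg_nonneg) auto

lemma gibbs_bounded_borel:
  assumes "bounded_borel h r"
  shows "bounded_borel (gibbs h) (exp (2 * r) / (2*pi))"
  unfolding bounded_borel_def
proof (intro conjI allI)
  have h: "h \<in> borel_measurable borel" using assms by (simp add: bounded_borel_def)
  have "(\<lambda>p. exp (h p) / circle_mean (\<lambda>p. exp (h p)) (snd p) / (2*pi)) \<in> borel_measurable borel"
    using circle_mean_measurable[OF bounded_borel_exp[OF assms]] h by measurable
  also have "(\<lambda>p. exp (h p) / circle_mean (\<lambda>p. exp (h p)) (snd p) / (2*pi)) = gibbs h"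
    unfolding gibbs_eq[symmetric] by simp
  finally show "gibbs h \<in> borel_measurable borel" .
  show "\<bar>gibbs h p\<bar> \<le> exp (2 * r) / (2*pi)" for p
    using gibbs_bounds(2)[OF assms, of p] gibbs_nonneg[of h p] by (simp add: field_simps)
qed

lemma integral_gibbs:
  assumes "bounded_borel h r"
  shows "(LINT u|circle. gibbs h (u, x)) = 1"
proof -
  let ?Z = "LINT u|circle. exp (h (u, x))"
  have "0 < circle_mean (\<lambda>p. exp (h p)) x"
    using circle_mean_exp_bounds(1)[OF assms, of x] exp_gt_zero[of "- r"] by linarith
  then have "?Z \<noteq> 0" by (auto simp: circle_mean_def)
  then show ?thesis by (simp add: gibbs_def)
qed

text \<open>What is left of \<open>2 * pi * gibbs h\<close> after its value 1 at h = 0 and its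
  linearisation there.\<close>

definition gibbs_remainder :: "(real \<times> real \<Rightarrow> real) \<Rightarrow> real \<times> real \<Rightarrow> real" where
  "gibbs_remainder h p = 2 * pi * gibbs h p - 1 - h p + circle_mean h (snd p)"

lemma gibbs_remainder_bounded_borel:
  assumes h: "bounded_borel h r"
  shows "\<exists>B. bounded_borel (gibbs_remainder h) B"
proof -
  have c: "bounded_borel (\<lambda>p::real \<times> real. circle_mean h (snd p)) r"
    using circle_mean_measurable[OF h] circle_mean_abs[of h r, OF bounded_borel_abs[OF h]]
    by (simp add: bounded_borel_def)
  have one: "bounded_borel (\<lambda>_::real \<times> real. - 1) 1" by (simp add: bounded_borel_def)
  have "gibbs_remainder h = (\<lambda>p. ((2 * pi * gibbs h p + -1) + -1 * h p) + circle_mean h (snd p))"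
    by (simp add: gibbs_remainder_def fun_eq_iff)
  moreover note bounded_borel_add[OF bounded_borel_add[OF bounded_borel_add[OF
    bounded_borel_scale[OF gibbs_bounded_borel[OF h], of "2 * pi"] one] bounded_borel_scale[OF h, of "- 1"]] c]
  ultimately show ?thesis by (intro exI) (simp only:)
qed

text \<open>\<^const>\<open>gibbs_remainder\<close> contains the \<open>u\<close>-mean of \<open>h\<close>, which the symmetrised interaction
  annihilates; without it the remainder would not be of second order.\<close>

lemma gibbs_remainder_lipschitz:
  assumes h: "bounded_borel h r" and k: "bounded_borel k r" and \<delta>: "\<And>p. \<bar>h p - k p\<bar> \<le> \<delta>"
  shows "\<bar>gibbs_remainder h p - gibbs_remainder k p\<bar> \<le> 4 * (exp (3 * r) - 1) * exp (3 * r) * \<delta>"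
proof -
  let ?a = "circle_mean (\<lambda>p. exp (h p)) (snd p)" and ?b = "circle_mean (\<lambda>p. exp (k p)) (snd p)"
  have r: "r \<ge> 0" using order_trans[OF abs_ge_zero] h by (auto simp: bounded_borel_def)
  have \<delta>0: "\<delta> \<ge> 0" using order_trans[OF abs_ge_zero \<delta>] .
  have E: "\<bar>exp (h p) - exp (k p) - (h p - k p)\<bar> \<le> (exp r - 1) * \<delta>" for p
  proof -
    have "\<bar>exp (h p) - exp (k p) - (h p - k p)\<bar> \<le> (exp r - 1) * \<bar>h p - k p\<bar>"
      by (rule abs_exp_remainder_le[OF bounded_borel_abs[OF h] bounded_borel_abs[OF k]])
    also have "\<dots> \<le> (exp r - 1) * \<delta>" using \<delta> r by (intro mult_left_mono) auto
    finally show ?thesis .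
  qed
  have diff: "bounded_borel (\<lambda>p. f p - g p) (A + B)" if "bounded_borel f A" "bounded_borel g B"
    for f g :: "real \<times> real \<Rightarrow> real" and A B
    using bounded_borel_add[OF that(1) bounded_borel_scale[OF that(2), of "-1"]] by simp
  note eh = bounded_borel_exp[OF h] and ek = bounded_borel_exp[OF k]
  \<comment> \<open>Means are linear, so the pointwise estimate \<open>E\<close> averages to the
    remainder estimate for the denominators.\<close>
  have "?a - ?b - (circle_mean h (snd p) - circle_mean k (snd p))
    = circle_mean (\<lambda>p. exp (h p) - exp (k p) - (h p - k p)) (snd p)"
    by (simp add: circle_mean_diff[OF eh ek] circle_mean_diff[OF h k]
        circle_mean_diff[OF diff[OF eh ek] diff[OF h k]])
  then have M: "\<bar>?a - ?b - (circle_mean h (snd p) - circle_mean k (snd p))\<bar> \<le> (exp r - 1) * \<delta>"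
    using circle_mean_abs[OF E] by simp
  have m: "\<bar>circle_mean h (snd p) - circle_mean k (snd p)\<bar> \<le> \<delta>"
    using circle_mean_abs[OF \<delta>] by (simp add: circle_mean_diff[OF h k])
  have "gibbs_remainder h p - gibbs_remainder k p
    = exp (h p) / ?a - exp (k p) / ?b - (h p - k p) + (circle_mean h (snd p) - circle_mean k (snd p))"
    by (simp add: gibbs_remainder_def gibbs_eq)
  then show ?thesis
    using quotient_remainder_le[OF r \<delta>0 exp_bounds[OF k] circle_mean_exp_bounds[OF h]
        circle_mean_exp_bounds[OF k] E \<delta> M m] by simp
qed

lemma gibbs_remainder_zero: "gibbs_remainder (\<lambda>_. 0) p = 0"
  by (simp add: gibbs_remainder_def gibbs_def circle_mean_def)

section \<open>The operator \<open>J\<close> on the normalised exponential\<close>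

context interaction_kernel
begin

text \<open>The constant 1 and the mean of \<open>h\<close> combine to a function of x alone, which
  \<open>J\<close> annihilates. So the linear part is \<open>J h\<close> itself, with no trace of
  the normalisation.\<close>

lemma J_gibbs:
  assumes h: "bounded_borel h r" and p: "fst p \<in> {0..2*pi}" "snd p \<in> {0..1}"
  shows "2 * pi * J (gibbs h) p = J h p + J (gibbs_remainder h) p"
proof -
  obtain B where B: "bounded_borel (gibbs_remainder h) B"
    using gibbs_remainder_bounded_borel[OF h] by blast
  define c where "c x = 1 - circle_mean h x" for x
  have c: "bounded_borel (\<lambda>p::real \<times> real. c (snd p)) (1 + r)"
  proof -
    have "\<bar>c x\<bar> \<le> 1 + r" for x
      using circle_mean_abs[of h r x, OF bounded_borel_abs[OF h]] abs_triangle_ineq4[of 1 "circle_mean h x"]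
      unfolding c_def by simp
    then show ?thesis using circle_mean_measurable[OF h] by (simp add: bounded_borel_def c_def)
  qed
  have "2 * pi * J (gibbs h) p = J (\<lambda>p. 2 * pi * gibbs h p) p" by (simp add: J_scale)
  also have "(\<lambda>p. 2 * pi * gibbs h p) = (\<lambda>p. (h p + gibbs_remainder h p) + c (snd p))"
    by (simp add: gibbs_remainder_def c_def fun_eq_iff)
  also have "J \<dots> p = J h p + J (gibbs_remainder h) p"
    by (simp only: J_add[OF p(2) bounded_borel_add[OF h B] c] J_add[OF p(2) h B] J_constant[OF p(1)])
  finally show ?thesis .
qed

text \<open>The Lipschitz constant of the remainder on the ball of radius r tends to 0 with r.
  \<open>K\<close> bounds the norm of \<open>JC\<close>, and its added 1 keeps it positive.\<close>

lemma JC_remainder_lipschitz: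
  assumes "\<eta> > 0"
  shows "\<exists>r>0. \<forall>h k. norm h \<le> r \<longrightarrow> norm k \<le> r \<longrightarrow>
    norm (JC (gibbs_remainder (apply_bcontfun h)) - JC (gibbs_remainder (apply_bcontfun k))) \<le> \<eta> * norm (h - k)"
proof -
  define K where "K = 2 * pi * kernel_bound + 1"
  have K: "K > 0" using kernel_bound_nonneg by (simp add: K_def add_nonneg_pos)
  have "((\<lambda>r::real. 4 * (exp (3 * r) - 1) * exp (3 * r)) \<longlongrightarrow> 4 * (exp (3 * 0) - 1) * exp (3 * 0)) (at_right 0)"
    by (intro tendsto_mult tendsto_diff tendsto_exp tendsto_const tendsto_ident_at)
  then have "eventually (\<lambda>r::real. 4 * (exp (3 * r) - 1) * exp (3 * r) < \<eta> / K) (at_right 0)"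
    using assms K by (intro order_tendstoD(2)) auto
  from eventually_happens'[OF trivial_limit_at_right_real eventually_conj[OF eventually_at_right_less this]]
  obtain r :: real where r: "r > 0" "4 * (exp (3 * r) - 1) * exp (3 * r) < \<eta> / K"
    by blast
  have "norm (JC (gibbs_remainder (apply_bcontfun h)) - JC (gibbs_remainder (apply_bcontfun k))) \<le> \<eta> * norm (h - k)"
    if hk: "norm h \<le> r" "norm k \<le> r" for h k
  proof -
    have h: "bounded_borel (apply_bcontfun h) r" and k: "bounded_borel (apply_bcontfun k) r"
      using bounded_borel_mono[OF bounded_borel_bcontfun] hk by auto
    obtain A where A: "bounded_borel (gibbs_remainder (apply_bcontfun h)) A"
      using gibbs_remainder_bounded_borel[OF h] by blast
    obtain B where B: "bounded_borel (gibbs_remainder (apply_bcontfun k)) B"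
      using gibbs_remainder_bounded_borel[OF k] by blast
    have "\<bar>apply_bcontfun h p - apply_bcontfun k p\<bar> \<le> norm (h - k)" for p
      using norm_bounded[of "h - k" p] by simp
    from gibbs_remainder_lipschitz[OF h k this]
    have "\<bar>gibbs_remainder (apply_bcontfun h) p - gibbs_remainder (apply_bcontfun k) p\<bar> \<le> \<eta> / K * norm (h - k)" for p
      by (rule order_trans) (rule mult_right_mono[OF less_imp_le[OF r(2)] norm_ge_zero])
    then have "bounded_borel (\<lambda>p. gibbs_remainder (apply_bcontfun h) p - gibbs_remainder (apply_bcontfun k) p)
        (\<eta> / K * norm (h - k))"
      using A B by (auto simp: bounded_borel_def)
    from JC_norm[OF this] have "norm (JC (gibbs_remainder (apply_bcontfun h)) - JC (gibbs_remainder (apply_bcontfun k)))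
      \<le> 2 * pi * (kernel_bound * (\<eta> / K * norm (h - k)))"
      by (simp only: JC_diff[OF A B])
    also have "\<dots> = (2 * pi * kernel_bound) * (\<eta> / K * norm (h - k))" by (simp only: mult.assoc)
    also have "\<dots> \<le> K * (\<eta> / K * norm (h - k))"
      using assms K by (intro mult_right_mono) (auto simp: K_def)
    also have "\<dots> = \<eta> * norm (h - k)" using K by simp
    finally show ?thesis .
  qed
  then show ?thesis using r(1) by blast
qed

end

section \<open>Eigenfunctions\<close>

lemma bounded_borel_mult:
  assumes "bounded_borel f A" "bounded_borel g B"
  shows "bounded_borel (\<lambda>p. f p * g p) (A * B)"
proof -
  have "\<bar>f p * g p\<bar> \<le> A * B" for p
    unfolding abs_mult using bounded_borel_abs[OF assms(1), of p] bounded_borel_abs[OF assms(2), of p]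
      bounded_borel_nonneg[OF assms(1)] by (intro mult_mono) auto
  then show ?thesis using assms by (auto simp: bounded_borel_def intro!: borel_measurable_times)
qed

lemma bounded_borel_integrable_cylinder:
  assumes "bounded_borel f B"
  shows "integrable cylinder f"
proof (rule cylinder.integrable_const_bound)
  show "f \<in> borel_measurable cylinder"
    using assms by (intro borel_measurable_lebesgue_onI) (simp add: bounded_borel_def)
  show "AE p in cylinder. norm (f p) \<le> B" using bounded_borel_abs[OF assms] by simp
qed

lemma integrable_cylinder_borel_version:
  fixes f :: "real \<times> real \<Rightarrow> real"
  assumes "integrable cylinder f"
  obtains g where "integrable lborel g" "AE p in cylinder. f p = g p"
proof -
  let ?f = "\<lambda>p. indicator ({0..2*pi} \<times> {0..1}) p *\<^sub>R f p"
  have S: "{0..2*pi} \<times> {0..1::real} \<inter> space lebesgue \<in> sets lebesgue"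
    using cylinder_in_sets by simp
  have int: "integrable lebesgue ?f" using assms unfolding integrable_restrict_space[OF S] .
  from completion_ex_borel_measurable_real[OF borel_measurable_integrable[OF this]]
  obtain g where g: "g \<in> borel_measurable lborel" "AE p in lborel. ?f p = g p" by blast
  then have ae: "AE p in lebesgue. ?f p = g p" by (simp add: AE_completion_iff)
  have "integrable lebesgue g" by (rule completion.integrable_cong_AE_complete[OF ae int])
  then have "integrable lborel g" using g(1) by (simp add: integrable_completion)
  moreover have "AE p in cylinder. f p = g p"
    unfolding AE_restrict_space_iff[OF S] using ae by eventually_elim auto
  ultimately show thesis using that by blast
qed

lemma integrable_lebesgue_on_subset:
  fixes f :: "real \<Rightarrow> real"
  assumes "integrable lborel f"
  shows "integrable (lebesgue_on {a..b}) f"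
proof -
  have "integrable lebesgue f"
    using assms borel_measurable_integrable[OF assms] by (simp add: integrable_completion)
  then have "integrable lebesgue (\<lambda>x. indicator {a..b} x *\<^sub>R f x)"
    by (intro integrable_mult_indicator) auto
  then show ?thesis by (simp add: integrable_restrict_space)
qed

text \<open>The integrable majorant \<open>n\<close> is what dominates \<open>J f\<close> for merely
  integrable \<open>f\<close>. Tonelli is applied to a Borel version on the plane, and
  \<open>n\<close> integrates its modulus over the whole line.\<close>

lemma integrable_cylinder_sections:
  fixes f :: "real \<times> real \<Rightarrow> real"
  assumes "integrable cylinder f"
  obtains n where "integrable unit_interval n"
    "AE y in unit_interval. integrable circle (\<lambda>v. f (v, y)) \<and> (LINT v|circle. \<bar>f (v, y)\<bar>) \<le> n y"
proof -
  obtain g where g: "integrable lborel g" "AE p in cylinder. f p = g p"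
    using integrable_cylinder_borel_version[OF assms] .
  then have int: "integrable (lborel \<Otimes>\<^sub>M lborel) g" "integrable (lborel \<Otimes>\<^sub>M lborel) (\<lambda>p. \<bar>g p\<bar>)"
    by (simp_all add: lborel_prod)
  define n where "n y = (LINT v|lborel. \<bar>g (v, y)\<bar>)" for y
  have borel: "g \<in> borel_measurable (borel \<Otimes>\<^sub>M borel)"
    using borel_measurable_integrable[OF g(1)] by (simp add: borel_prod)
  have "integrable lborel n"
    unfolding n_def using lborel_pair.integrable_snd[of "\<lambda>x y. \<bar>g (x, y)\<bar>"] int(2)
    by (simp add: split_beta')
  then have n: "integrable unit_interval n"
    by (rule integrable_lebesgue_on_subset)
  have "AE y in lborel. integrable lborel (\<lambda>v. g (v, y))"
    using lborel_pair.AE_integrable_snd[of "\<lambda>x y. g (x, y)"] int(1) by simp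
  then have "AE y in lborel. y \<in> {0..1} \<longrightarrow> integrable lborel (\<lambda>v. g (v, y))"
    by eventually_elim simp
  then have "AE y in unit_interval. integrable lborel (\<lambda>v. g (v, y))"
    by (simp add: AE_restrict_space_iff AE_completion_iff)
  moreover have "AE y in unit_interval. AE v in circle. f (v, y) = g (v, y)"
    by (rule AE_cylinder_sections[OF g(2)])
  ultimately have "AE y in unit_interval. integrable circle (\<lambda>v. f (v, y)) \<and> (LINT v|circle. \<bar>f (v, y)\<bar>) \<le> n y"
  proof eventually_elim
    case (elim y)
    have leb: "integrable lebesgue (\<lambda>v. g (v, y))"
      using elim(1) borel_measurable_integrable[OF elim(1)] by (simp add: integrable_completion)
    have gc: "integrable circle (\<lambda>v. g (v, y))" by (rule integrable_lebesgue_on_subset[OF elim(1)])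
    have "integrable circle (\<lambda>v. f (v, y))"
      by (rule circle.integrable_cong_AE_complete[OF _ gc]) (use elim(2) in eventually_elim, simp)
    moreover have "(LINT v|circle. \<bar>f (v, y)\<bar>) = (LINT v|circle. \<bar>g (v, y)\<bar>)"
      by (rule circle.integral_cong_AE_complete) (use elim(2) in eventually_elim, simp)
    moreover have "(LINT v|circle. \<bar>g (v, y)\<bar>) \<le> n y"
    proof -
      have "(LINT v|circle. \<bar>g (v, y)\<bar>) = (LINT v|lebesgue. indicator {0..2*pi} v *\<^sub>R \<bar>g (v, y)\<bar>)"
        by (simp add: integral_restrict_space)
      also have "\<dots> \<le> (LINT v|lebesgue. \<bar>g (v, y)\<bar>)"
        using leb by (intro integral_mono') (auto simp: indicator_def)
      also have "\<dots> = n y"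
        unfolding n_def using borel_measurable_integrable[OF elim(1)] by (intro integral_completion) simp
      finally show ?thesis .
    qed
    ultimately show ?case by simp
  qed
  then show thesis using that n by blast
qed

context interaction_kernel
begin

text \<open>The kernel is bounded, so integrability of \<open>f\<close> suffices for a bounded
  image. For an eigenfunction this is the first gain of regularity.\<close>

lemma J_integrable_bound:
  assumes "integrable cylinder f"
  obtains K where "\<And>u x. x \<in> {0..1} \<Longrightarrow> \<bar>J f (u, x)\<bar> \<le> K"
proof -
  obtain n where n: "integrable unit_interval n"
    "AE y in unit_interval. integrable circle (\<lambda>v. f (v, y)) \<and> (LINT v|circle. \<bar>f (v, y)\<bar>) \<le> n y"
    using integrable_cylinder_sections[OF assms] .
  have "\<bar>J f (u, x)\<bar> \<le> (LINT y|unit_interval. kernel_bound * n y)" if x: "x \<in> {0..1}" for u x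
  proof -
    have "\<bar>J f (u, x)\<bar> \<le> (LINT y|unit_interval. \<bar>W x y * angular f u y\<bar>)"
      unfolding J_eq by (rule integral_abs_bound)
    also have "\<dots> \<le> (LINT y|unit_interval. kernel_bound * n y)"
    proof (rule integral_mono_AE')
      show "integrable unit_interval (\<lambda>y. kernel_bound * n y)" using n(1) by simp
      have *: "\<bar>W x y * angular f u y\<bar> \<le> kernel_bound * n y"
        if "y \<in> {0..1}" "integrable circle (\<lambda>v. f (v, y))" "(LINT v|circle. \<bar>f (v, y)\<bar>) \<le> n y" for y
      proof -
        have "\<bar>angular f u y\<bar> \<le> (LINT v|circle. \<bar>even_kernel u v * f (v, y)\<bar>)"
          unfolding angular_def by (rule integral_abs_bound)
        also have "\<dots> \<le> (LINT v|circle. kernel_bound * \<bar>f (v, y)\<bar>)"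
          using that(2) even_kernel_bound kernel_bound_nonneg
          by (intro integral_mono') (auto simp: abs_mult intro!: mult_right_mono)
        also have "\<dots> = kernel_bound * (LINT v|circle. \<bar>f (v, y)\<bar>)" by simp
        also have "\<dots> \<le> kernel_bound * n y" using that(3) kernel_bound_nonneg by (rule mult_left_mono)
        finally have "\<bar>angular f u y\<bar> \<le> kernel_bound * n y" .
        moreover have "\<bar>W x y * angular f u y\<bar> \<le> 1 * \<bar>angular f u y\<bar>"
          unfolding abs_mult using W_range[OF x that(1)] by (intro mult_right_mono) auto
        ultimately show ?thesis by simp
      qed
      show ae: "AE y in unit_interval. \<bar>W x y * angular f u y\<bar> \<le> kernel_bound * n y"
        using n(2) AE_space by eventually_elim (use * in auto)
      show "AE y in unit_interval. 0 \<le> kernel_bound * n y"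
        using ae by eventually_elim (rule order_trans[OF abs_ge_zero])
    qed
    finally show ?thesis .
  qed
  then show thesis using that by blast
qed

lemma even_tangent_interaction:
  assumes f: "f \<in> even_tangent" and u: "u \<in> {0..2*pi}"
  shows "interaction W D f (u, x) = J f (u, x)"
proof (rule interaction_eq_J[OF u])
  have int: "integrable cylinder f" and even: "AE (u, x) in cylinder. f (2*pi - u, x) = f (u, x)"
    and mean: "AE x in unit_interval. (LINT u|circle. f (u, x)) = 0"
    using f by (auto simp: even_tangent_def even_L1_def)
  show "AE y in unit_interval. integrable circle (\<lambda>v. f (v, y))"
  proof -
    obtain n where "AE y in unit_interval. integrable circle (\<lambda>v. f (v, y)) \<and> (LINT v|circle. \<bar>f (v, y)\<bar>) \<le> n y"
      using integrable_cylinder_sections[OF int] .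
    then show ?thesis by eventually_elim simp
  qed
  show "AE y in unit_interval. AE v in circle. f (2*pi - v, y) = f (v, y)"
    using AE_cylinder_sections[OF even] by simp
  show "AE y in unit_interval. (LINT v|circle. f (v, y)) = 0" by (rule mean)
qed

text \<open>Bootstrapping: f = (c / \<mu>) J f almost everywhere, so \<open>f\<close> is essentially
  bounded. Replaced by a bounded Borel \<open>k\<close>, it has a continuous image, and a multiple
  of that image is the representative; it satisfies the equation at every point.\<close>

lemma eigenfunction_representative:
  assumes f: "f \<in> even_tangent" and \<mu>: "\<mu> \<noteq> 0"
    and eigen: "AE p in cylinder. T_operator \<beta> W D f p = \<mu> * f p"
  obtains h where "AE p in cylinder. f p = apply_bcontfun h p"
    "(- (\<beta> / (2*pi))) *\<^sub>R JC (apply_bcontfun h) = \<mu> *\<^sub>R h"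
proof -
  define c where "c = - (\<beta> / (2*pi))"
  have int: "integrable cylinder f" using f by (auto simp: even_tangent_def even_L1_def)
  obtain K where K: "\<And>u x. x \<in> {0..1} \<Longrightarrow> \<bar>J f (u, x)\<bar> \<le> K"
    using J_integrable_bound[OF int] by blast
  have fJ: "AE p in cylinder. f p = c / \<mu> * J f p"
    using eigen AE_space
  proof eventually_elim
    case (elim p)
    obtain u x where p: "p = (u, x)" by fastforce
    have "u \<in> {0..2*pi}" using elim(2) p by simp
    then have "interaction W D f p = J f p"
      unfolding p by (rule even_tangent_interaction[OF f])
    then have "c * J f p = \<mu> * f p" using elim(1) by (simp only: T_operator_def c_def)
    then show ?case using \<mu> by (simp add: field_simps)
  qed
  define B where "B = \<bar>c / \<mu>\<bar> * K"
  have K0: "K \<ge> 0" using order_trans[OF abs_ge_zero K[of 0 0]] by simp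
  have fB: "AE p in cylinder. \<bar>f p\<bar> \<le> B"
    using fJ AE_space
  proof eventually_elim
    case (elim p)
    then have "snd p \<in> {0..1}" by auto
    from K[OF this, of "fst p"] have "\<bar>J f p\<bar> \<le> K" by simp
    then have "\<bar>c / \<mu>\<bar> * \<bar>J f p\<bar> \<le> B" unfolding B_def by (intro mult_left_mono) auto
    moreover have "\<bar>f p\<bar> = \<bar>c / \<mu>\<bar> * \<bar>J f p\<bar>" using elim(1) by (simp only: abs_mult)
    ultimately show ?case by linarith
  qed
  obtain g where g: "integrable lborel g" "AE p in cylinder. f p = g p"
    using integrable_cylinder_borel_version[OF int] .
  \<comment> \<open>\<open>g\<close> agrees with \<open>f\<close> only almost everywhere on the
    cylinder and may be unbounded; clipping at \<open>B\<close> keeps the agreement.\<close>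
  define k where "k p = max (- B) (min B (g p))" for p
  have k: "bounded_borel k B"
  proof -
    have "k \<in> borel_measurable borel"
      using borel_measurable_integrable[OF g(1)] unfolding k_def by simp
    moreover have "B \<ge> 0" using K0 by (simp add: B_def)
    ultimately show ?thesis by (auto simp: bounded_borel_def k_def)
  qed
  have fk: "AE p in cylinder. f p = k p"
    using g(2) fB by eventually_elim (auto simp: k_def)
  have Jfk: "J f = J k" by (rule J_cong_AE[OF AE_cylinder_sections[OF fk]])
  define h where "h = (c / \<mu>) *\<^sub>R JC k"
  have fh: "AE p in cylinder. f p = apply_bcontfun h p"
    using fJ AE_space
  proof eventually_elim
    case (elim p)
    then have "cylinder_clamp p = p" by (cases p) auto
    then show ?case using elim by (simp add: h_def JC_apply[OF k] Jfk)
  qed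
  have "J (apply_bcontfun h) = J k"
    using J_cong_AE[OF AE_cylinder_sections[OF fh]] Jfk by simp
  then have "JC (apply_bcontfun h) = JC k" by (simp add: JC_def)
  then have "c *\<^sub>R JC (apply_bcontfun h) = \<mu> *\<^sub>R h" using \<mu> by (simp add: h_def)
  then show thesis using that fh by (simp add: c_def)
qed

text \<open>Evenness and zero mean are inherited from the range of \<open>J\<close>, so eigenvectors
  in the full space fall under the simplicity hypothesis.\<close>

lemma eigenvector_in_even_tangent:
  assumes \<mu>: "\<mu> \<noteq> 0" and eigen: "(- (\<beta> / (2*pi))) *\<^sub>R JC (apply_bcontfun h) = \<mu> *\<^sub>R h"
  shows "apply_bcontfun h \<in> even_tangent"
    and "AE p in cylinder. T_operator \<beta> W D (apply_bcontfun h) p = \<mu> * apply_bcontfun h p"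
proof -
  define c where "c = - (\<beta> / (2*pi))"
  have ch: "c * J (apply_bcontfun h) (cylinder_clamp p) = \<mu> * apply_bcontfun h p" for p
  proof -
    have "apply_bcontfun (c *\<^sub>R JC (apply_bcontfun h)) p = apply_bcontfun (\<mu> *\<^sub>R h) p"
      using eigen by (simp only: c_def)
    then show ?thesis by (simp add: JC_apply[OF bounded_borel_bcontfun])
  qed
  have h: "apply_bcontfun h (u, x) = c / \<mu> * J (apply_bcontfun h) (u, x)"
    if "u \<in> {0..2*pi}" "x \<in> {0..1}" for u x
    using ch[of "(u, x)"] that \<mu> by (simp add: field_simps)
  have even: "apply_bcontfun h (2*pi - u, x) = apply_bcontfun h (u, x)"
    if "u \<in> {0..2*pi}" "x \<in> {0..1}" for u x
    using h[OF that] h[of "2*pi - u" x] that by (simp add: J_even)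
  have mean: "(LINT u|circle. apply_bcontfun h (u, x)) = 0" if x: "x \<in> {0..1}" for x
  proof -
    have "(LINT u|circle. apply_bcontfun h (u, x)) = (LINT u|circle. c / \<mu> * J (apply_bcontfun h) (u, x))"
      using h[OF _ x] by (intro Bochner_Integration.integral_cong) auto
    then show ?thesis using J_mean_zero[OF x bounded_borel_bcontfun] by simp
  qed
  show tangent: "apply_bcontfun h \<in> even_tangent"
    unfolding even_tangent_def even_L1_def
    using bounded_borel_integrable_cylinder[OF bounded_borel_bcontfun] even mean
    by auto
  show "AE p in cylinder. T_operator \<beta> W D (apply_bcontfun h) p = \<mu> * apply_bcontfun h p"
  proof (rule AE_I2)
    fix p assume "p \<in> space cylinder"
    then obtain u x where p: "p = (u, x)" "u \<in> {0..2*pi}" "x \<in> {0..1}" by (cases p) auto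
    show "T_operator \<beta> W D (apply_bcontfun h) p = \<mu> * apply_bcontfun h p"
    proof -
      have "interaction W D (apply_bcontfun h) p = J (apply_bcontfun h) p"
        unfolding p(1) by (rule even_tangent_interaction[OF tangent p(2)])
      moreover have "cylinder_clamp p = p" using p by simp
      ultimately show ?thesis using ch[of p] by (simp only: T_operator_def c_def)
    qed
  qed
qed

text \<open>Both functions are multiples of their images, and images ignore null sets and values off
  the cylinder; this lifts almost-everywhere proportionality to equality on the plane.\<close>

lemma eigenvector_unique:
  assumes \<mu>: "\<mu> \<noteq> 0" and h: "c *\<^sub>R JC (apply_bcontfun h) = \<mu> *\<^sub>R h"
    and k: "c *\<^sub>R JC (apply_bcontfun k) = \<mu> *\<^sub>R k"
    and ae: "AE p in cylinder. apply_bcontfun k p = a * apply_bcontfun h p"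
  shows "k = a *\<^sub>R h"
proof -
  have "J (apply_bcontfun k) = J (\<lambda>p. a * apply_bcontfun h p)"
    by (rule J_cong_AE[OF AE_cylinder_sections[OF ae]])
  then have "JC (apply_bcontfun k) = a *\<^sub>R JC (apply_bcontfun h)"
    using JC_scale[OF bounded_borel_bcontfun, of a h] by (simp add: JC_def)
  then have "\<mu> *\<^sub>R k = \<mu> *\<^sub>R a *\<^sub>R h" using h k by (metis scaleR_left_commute)
  then show ?thesis using \<mu> by (simp only: scaleR_cancel_left simp_thms)
qed

section \<open>The pairing as a bounded functional\<close>

lemma pairing_bounded_linear:
  "bounded_linear (\<lambda>g. pairing (apply_bcontfun h) (apply_bcontfun g))"
proof -
  have prod: "bounded_borel (\<lambda>p. apply_bcontfun h p * apply_bcontfun g p) (norm h * norm g)" for g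
    by (rule bounded_borel_mult[OF bounded_borel_bcontfun bounded_borel_bcontfun])
  have pairing_eq: "pairing (apply_bcontfun h) (apply_bcontfun g)
    = 2 * pi * (LINT x|unit_interval. circle_mean (\<lambda>p. apply_bcontfun h p * apply_bcontfun g p) x)" for g
    by (simp add: pairing_def circle_mean_def)
  have meas: "circle_mean f \<in> borel_measurable borel" if "bounded_borel f B" for f B
  proof -
    have "(\<lambda>x. circle_mean f (snd (0::real, x))) \<in> borel_measurable borel"
      by (rule measurable_compose[OF _ circle_mean_measurable[OF that], of "\<lambda>x. (0, x)"])
        (intro borel_measurable_Pair borel_measurable_const measurable_ident_sets refl)
    then show ?thesis by simp
  qed
  have int: "integrable unit_interval (circle_mean f)" if "bounded_borel f B" for f B
    using borel_measurable_lebesgue_onI[OF meas[OF that]] circle_mean_abs[of f B, OF bounded_borel_abs[OF that]]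
    by (intro unit_interval.integrable_const_bound[where B=B]) auto
  have mean_add: "circle_mean (\<lambda>p. f p + g p) x = circle_mean f x + circle_mean g x"
    if "bounded_borel f A" "bounded_borel g B" for f g A B x
    using bounded_borel_integrable_circle[OF that(1), of x] bounded_borel_integrable_circle[OF that(2), of x]
    by (simp add: circle_mean_def add_divide_distrib)
  show ?thesis
  proof (rule bounded_linear_intro)
    show "pairing (apply_bcontfun h) (apply_bcontfun (f + g))
      = pairing (apply_bcontfun h) (apply_bcontfun f) + pairing (apply_bcontfun h) (apply_bcontfun g)" for f g
    proof -
      have "pairing (apply_bcontfun h) (apply_bcontfun (f + g)) = 2 * pi * (LINT x|unit_interval.
          circle_mean (\<lambda>p. apply_bcontfun h p * apply_bcontfun f p + apply_bcontfun h p * apply_bcontfun g p) x)"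
        unfolding pairing_eq by (simp add: distrib_left)
      then show ?thesis
        using int[OF prod[of f]] int[OF prod[of g]]
        by (simp only: pairing_eq mean_add[OF prod prod]) (simp add: distrib_left)
    qed
    show "pairing (apply_bcontfun h) (apply_bcontfun (a *\<^sub>R g)) = a *\<^sub>R pairing (apply_bcontfun h) (apply_bcontfun g)" for a g
      by (simp add: pairing_def mult.left_commute)
    show "norm (pairing (apply_bcontfun h) (apply_bcontfun g)) \<le> norm g * (2 * pi * norm h)" for g
    proof -
      have "\<bar>LINT x|unit_interval. circle_mean (\<lambda>p. apply_bcontfun h p * apply_bcontfun g p) x\<bar>
        \<le> (LINT x|unit_interval. \<bar>circle_mean (\<lambda>p. apply_bcontfun h p * apply_bcontfun g p) x\<bar>)"
        by (rule integral_abs_bound)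
      also have "\<dots> \<le> (LINT x|unit_interval. norm h * norm g)"
        using circle_mean_abs[of "\<lambda>p. apply_bcontfun h p * apply_bcontfun g p", OF bounded_borel_abs[OF prod]]
        by (intro integral_mono') auto
      finally show ?thesis by (simp add: pairing_eq abs_mult mult_ac)
    qed
  qed
qed

lemma pairing_commute: "pairing f g = pairing g f"
  by (simp add: pairing_def mult.commute)

lemma pairing_cong:
  "(\<And>u x. u \<in> {0..2*pi} \<Longrightarrow> x \<in> {0..1} \<Longrightarrow> g (u, x) = g' (u, x)) \<Longrightarrow> pairing f g = pairing f g'"
  unfolding pairing_def by (intro Bochner_Integration.integral_cong refl) auto

text \<open>A nonzero \<open>h\<close> could vanish on the cylinder, which is all the pairing sees;
  a nonzero image excludes this. If the integral of the square is 0, then h = 0 almost everywhere on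
  the cylinder and its image is 0.\<close>

lemma pairing_self_nonzero:
  assumes "JC (apply_bcontfun h) \<noteq> 0"
  shows "pairing (apply_bcontfun h) (apply_bcontfun h) \<noteq> 0"
proof
  let ?q = "\<lambda>p. apply_bcontfun h p * apply_bcontfun h p"
  assume zero: "pairing (apply_bcontfun h) (apply_bcontfun h) = 0"
  have q: "bounded_borel ?q (norm h * norm h)"
    by (rule bounded_borel_mult[OF bounded_borel_bcontfun bounded_borel_bcontfun])
  have int: "integrable circle (\<lambda>u. ?q (u, x))" for x by (rule bounded_borel_integrable_circle[OF q])
  have "integrable unit_interval (\<lambda>x. LINT u|circle. ?q (u, x))"
  proof (rule unit_interval.integrable_const_bound)
    note bounded_borel_measurable_pair[OF q, measurable]
    have "(\<lambda>x. LINT u|circle. ?q (u, x)) \<in> borel_measurable borel" by measurable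
    then show "(\<lambda>x. LINT u|circle. ?q (u, x)) \<in> borel_measurable unit_interval"
      by (rule borel_measurable_lebesgue_onI)
    show "AE x in unit_interval. norm (LINT u|circle. ?q (u, x)) \<le> 2 * pi * (norm h * norm h)"
      unfolding real_norm_def using bounded_borel_abs[OF q] by (intro AE_I2 abs_integral_circle_le)
  qed
  then have "AE x in unit_interval. (LINT u|circle. ?q (u, x)) = 0"
    using zero unfolding pairing_def by (subst (asm) integral_nonneg_eq_0_iff_AE) auto
  then have "AE x in unit_interval. AE u in circle. apply_bcontfun h (u, x) = 0"
  proof eventually_elim
    case (elim x)
    then have "AE u in circle. ?q (u, x) = 0"
      using int[of x] by (subst (asm) integral_nonneg_eq_0_iff_AE) auto
    then show ?case by simp
  qed
  then have "J (apply_bcontfun h) = J (\<lambda>_. 0)" by (rule J_cong_AE)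
  then have "apply_bcontfun (JC (apply_bcontfun h)) p = 0" for p
    by (simp add: JC_apply[OF bounded_borel_bcontfun] J_def split_beta)
  then have "JC (apply_bcontfun h) = 0" by (intro bcontfun_eqI) simp
  then show False using assms by contradiction
qed

end

section \<open>The bifurcation point\<close>

text \<open>Because \<open>inverse 0 = 0\<close>, \<open>theta_nonzero\<close> keeps the spectral
  hypothesis away from the eigenvalue 0, to which the compactness argument does not apply.\<close>

theorem theorem3p4:
  fixes W :: "real \<Rightarrow> real \<Rightarrow> real" and D :: "real \<Rightarrow> real" and \<beta> \<theta>\<^sub>0 :: real
  assumes W_range: "\<forall>x\<in>{0..1}. \<forall>y\<in>{0..1}. 0 \<le> W x y \<and> W x y \<le> 1"
    and W_sym: "\<forall>x\<in>{0..1}. \<forall>y\<in>{0..1}. W x y = W y x"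
    and W_measurable: "(\<lambda>(x, y). W x y) \<in> borel_measurable (lebesgue_on ({0..1} \<times> {0..1}))"
    and W_section_measurable: "\<forall>x\<in>{0..1}. W x \<in> borel_measurable (lebesgue_on {0..1})"
    and W_continuous: "\<forall>\<epsilon>>0. \<exists>\<delta>>0. \<forall>x\<^sub>1\<in>{0..1}. \<forall>x\<^sub>2\<in>{0..1}. \<bar>x\<^sub>1 - x\<^sub>2\<bar> < \<delta> \<longrightarrow>
          (LINT y|lebesgue_on {0..1}. \<bar>W x\<^sub>1 y - W x\<^sub>2 y\<bar>) < \<epsilon>"
    and D_lipschitz: "\<exists>L. L-lipschitz_on {0..2*pi} D"
    and D_even: "\<forall>u. D (- u) = D u"
    and D_periodic: "\<forall>u. D (u + 2*pi) = D u"
    and beta_pos: "\<beta> > 0"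
    and theta_nonzero: "\<theta>\<^sub>0 \<noteq> 0"
    and simple: "simple_eigenvalue_on cylinder even_tangent (T_operator \<beta> W D) (inverse \<theta>\<^sub>0)"
  shows "bifurcation_point cylinder even_densities (stationarity_map \<beta> W D) (\<lambda>_. 1 / (2*pi)) \<theta>\<^sub>0"
proof -
  obtain L where L: "L-lipschitz_on {0..2*pi} D" using D_lipschitz by blast
  interpret interaction_kernel W D L
    by unfold_locales (use W_range W_sym W_measurable W_section_measurable W_continuous L D_even D_periodic in \<open>blast+\<close>)
  define c where "c = - (\<beta> / (2*pi))"
  define \<mu> where "\<mu> = inverse \<theta>\<^sub>0"
  have \<mu>: "\<mu> \<noteq> 0" using theta_nonzero by (simp add: \<mu>_def)
  obtain f where f: "f \<in> even_tangent" "\<not> (AE p in cylinder. f p = 0)"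
      "AE p in cylinder. T_operator \<beta> W D f p = \<mu> * f p"
    and f_unique: "\<And>\<psi>. \<psi> \<in> even_tangent \<Longrightarrow> AE p in cylinder. T_operator \<beta> W D \<psi> p = \<mu> * \<psi> p \<Longrightarrow>
      \<exists>a. AE p in cylinder. \<psi> p = a * f p"
    using simple unfolding simple_eigenvalue_on_def \<mu>_def by blast
  obtain \<phi> where f\<phi>: "AE p in cylinder. f p = apply_bcontfun \<phi> p"
    and \<phi>: "c *\<^sub>R JC (apply_bcontfun \<phi>) = \<mu> *\<^sub>R \<phi>"
    using eigenfunction_representative[OF f(1) \<mu> f(3)] unfolding c_def by blast
  \<comment> \<open>Simplicity modulo null sets on \<open>even_tangent\<close> becomes simplicity in
    the full space of bounded continuous functions.\<close>
  have unique: "\<exists>a. \<psi> = a *\<^sub>R \<phi>" if \<psi>: "c *\<^sub>R JC (apply_bcontfun \<psi>) = \<mu> *\<^sub>R \<psi>" for \<psi>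
  proof -
    obtain a where "AE p in cylinder. apply_bcontfun \<psi> p = a * f p"
      using f_unique eigenvector_in_even_tangent[OF \<mu> \<psi>[unfolded c_def]] by blast
    then have "AE p in cylinder. apply_bcontfun \<psi> p = a * apply_bcontfun \<phi> p"
      using f\<phi> by eventually_elim simp
    then show ?thesis using eigenvector_unique[OF \<mu> \<phi> \<psi>] by blast
  qed
  have "\<phi> \<noteq> 0" using f(2) f\<phi> by auto
  then have "JC (apply_bcontfun \<phi>) \<noteq> 0" using \<phi> \<mu> by auto
  then have \<phi>\<phi>: "pairing (apply_bcontfun \<phi>) (apply_bcontfun \<phi>) \<noteq> 0" by (rule pairing_self_nonzero)
  define l where "l g = pairing (apply_bcontfun \<phi>) (apply_bcontfun g) / pairing (apply_bcontfun \<phi>) (apply_bcontfun \<phi>)" for g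
  define T where "T h = c *\<^sub>R JC (apply_bcontfun h)" for h
  define R where "R h = c *\<^sub>R JC (gibbs_remainder (apply_bcontfun h))" for h
  have T_linear: "bounded_linear T"
    unfolding T_def by (rule bounded_linear_compose[OF bounded_linear_scaleR_right JC_bounded_linear])
  have T_compact: "compact_map T"
    unfolding compact_map_def T_def
  proof (intro allI impI)
    fix h :: "nat \<Rightarrow> (real \<times> real) \<Rightarrow>\<^sub>C real" assume "bounded (range h)"
    then obtain r y where "strict_mono r" "(\<lambda>n. JC (apply_bcontfun (h (r n)))) \<longlonglongrightarrow> y"
      using JC_compact unfolding compact_map_def by blast
    then show "\<exists>r y. strict_mono r \<and> (\<lambda>n. c *\<^sub>R JC (apply_bcontfun (h (r n)))) \<longlonglongrightarrow> y"
      using tendsto_scaleR[OF tendsto_const] by blast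
  qed
  have l_linear: "bounded_linear l"
    unfolding l_def by (rule bounded_linear_compose[OF bounded_linear_divide pairing_bounded_linear])
  have l_T: "l (T g) = \<mu> * l g" for g
  proof -
    have JC_J: "pairing h (apply_bcontfun (JC (apply_bcontfun k))) = pairing h (J (apply_bcontfun k))" for h k
      by (rule pairing_cong) (simp add: JC_apply[OF bounded_borel_bcontfun])
    have scale: "pairing h (apply_bcontfun (a *\<^sub>R k)) = a * pairing h (apply_bcontfun k)" for h a k
      by (simp add: pairing_def mult.left_commute)
    have "pairing (apply_bcontfun \<phi>) (apply_bcontfun (T g)) = c * pairing (apply_bcontfun \<phi>) (J (apply_bcontfun g))"
      by (simp only: T_def scale JC_J)
    also have "\<dots> = c * pairing (apply_bcontfun g) (J (apply_bcontfun \<phi>))"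
      by (simp only: pairing_J[OF bounded_borel_bcontfun bounded_borel_bcontfun])
    also have "\<dots> = pairing (apply_bcontfun g) (apply_bcontfun (c *\<^sub>R JC (apply_bcontfun \<phi>)))"
      by (simp only: scale JC_J)
    also have "\<dots> = \<mu> * pairing (apply_bcontfun \<phi>) (apply_bcontfun g)"
      by (simp only: \<phi> scale pairing_commute[of "apply_bcontfun g"])
    finally show ?thesis by (simp add: l_def)
  qed
  have T_\<phi>: "T \<phi> = \<mu> *\<^sub>R \<phi>" using \<phi> by (simp only: T_def)
  have T_simple: "\<exists>a. \<psi> = a *\<^sub>R \<phi>" if "T \<psi> = \<mu> *\<^sub>R \<psi>" for \<psi>
    using unique that by (simp only: T_def)
  have l_\<phi>: "l \<phi> = 1" using \<phi>\<phi> by (simp add: l_def)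
  have R_small: "\<exists>r>0. \<forall>h k. norm h \<le> r \<longrightarrow> norm k \<le> r \<longrightarrow> norm (R h - R k) \<le> \<eta> * norm (h - k)"
    if \<eta>: "\<eta> > 0" for \<eta>
  proof -
    obtain r where r: "r > 0" "\<And>h k. norm h \<le> r \<Longrightarrow> norm k \<le> r \<Longrightarrow>
        norm (JC (gibbs_remainder (apply_bcontfun h)) - JC (gibbs_remainder (apply_bcontfun k)))
          \<le> \<eta> / (\<bar>c\<bar> + 1) * norm (h - k)"
      using JC_remainder_lipschitz[of "\<eta> / (\<bar>c\<bar> + 1)"] \<eta> by (meson abs_ge_zero add_nonneg_pos divide_pos_pos zero_less_one)
    have "norm (R h - R k) \<le> \<eta> * norm (h - k)" if "norm h \<le> r" "norm k \<le> r" for h k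
    proof -
      have "norm (R h - R k) = \<bar>c\<bar> * norm (JC (gibbs_remainder (apply_bcontfun h)) - JC (gibbs_remainder (apply_bcontfun k)))"
        unfolding R_def scaleR_diff_right[symmetric] by simp
      also have "\<dots> \<le> (\<bar>c\<bar> + 1) * (\<eta> / (\<bar>c\<bar> + 1) * norm (h - k))"
        using r(2)[OF that] by (intro mult_mono) auto
      also have "\<dots> = \<eta> * norm (h - k)" by simp
      finally show ?thesis .
    qed
    then show ?thesis using r(1) by blast
  qed
  have R_zero: "R 0 = 0"
  proof -
    \<comment> \<open>Zero is written as a product to match \<open>JC_scale\<close> with factor
      0.\<close>
    have "gibbs_remainder (apply_bcontfun 0) = (\<lambda>_. 0 * 0)"
      by (simp add: fun_eq_iff gibbs_remainder_zero)
    then show ?thesis using JC_scale[of "\<lambda>_. 0" 0 0] by (simp add: R_def bounded_borel_def)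
  qed
  \<comment> \<open>\<open>fixed\<close> makes \<open>h\<close> a potential of its own density. The
    interaction differs from \<open>J\<close> by a function of x alone, which yields a common factor
    \<open>C\<close> in numerator and normaliser and cancels.\<close>
  have stationary: "gibbs_map \<beta> W D (gibbs h) \<theta> p = gibbs h p"
    if h: "bounded_borel h r" and p: "p \<in> space cylinder"
      and fixed: "\<And>u x. u \<in> {0..2*pi} \<Longrightarrow> x \<in> {0..1} \<Longrightarrow> h (u, x) = - \<beta> * \<theta> * J (gibbs h) (u, x)"
    for h r p and \<theta> :: real
  proof -
    obtain u x where ux: "p = (u, x)" "u \<in> {0..2*pi}" "x \<in> {0..1}" using p by (cases p) auto
    define C where "C = exp (- \<beta> * \<theta> * (LINT y|unit_interval. W x y * (D_mean * 1)))"
    have even: "gibbs h (2*pi - v, y) = gibbs h (v, y)" if "v \<in> {0..2*pi}" "y \<in> {0..1}" for v y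
      using fixed[OF that] fixed[of "2*pi - v" y] that by (simp add: gibbs_def J_even)
    have E: "exp (- \<beta> * \<theta> * interaction W D (gibbs h) (v, x)) = exp (h (v, x)) * C" if v: "v \<in> {0..2*pi}" for v
    proof -
      have "interaction W D (gibbs h) (v, x) = J (gibbs h) (v, x) + (LINT y|unit_interval. W x y * (D_mean * 1))"
        using even integral_gibbs[OF h]
        by (intro interaction_eq_J_plus[OF v ux(3) gibbs_bounded_borel[OF h]])
      then show ?thesis using fixed[OF v ux(3)] by (simp add: C_def distrib_left flip: exp_add)
    qed
    have "(LINT v|circle. exp (- \<beta> * \<theta> * interaction W D (gibbs h) (v, x))) = (LINT v|circle. exp (h (v, x)) * C)"
      using E by (intro Bochner_Integration.integral_cong) auto
    moreover have "C \<noteq> 0" by (simp add: C_def)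
    ultimately show ?thesis
      using E[OF ux(2)] by (simp add: gibbs_map_def gibbs_def ux(1))
  qed
  have density: "gibbs h \<in> even_densities"
    if h: "bounded_borel h r" and even: "\<And>u x. u \<in> {0..2*pi} \<Longrightarrow> x \<in> {0..1} \<Longrightarrow> h (2*pi - u, x) = h (u, x)"
    for h r
    unfolding even_densities_def even_L1_def
    using bounded_borel_integrable_cylinder[OF gibbs_bounded_borel[OF h]] gibbs_nonneg integral_gibbs[OF h] even
    by (auto simp: gibbs_def)
  have uniform: "gibbs (\<lambda>_. 0) = (\<lambda>_. 1 / (2*pi))" by (simp add: gibbs_def fun_eq_iff)
  have zero_bb: "bounded_borel (\<lambda>_::real \<times> real. 0) 0" by (simp add: bounded_borel_def)
  have J_uniform: "J (\<lambda>_. 1 / (2*pi)) (u, x) = 0" if "u \<in> {0..2*pi}" for u x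
    using J_constant[of "(u, x)" "\<lambda>_. 1 / (2*pi)"] that by simp
  show ?thesis
    unfolding bifurcation_point_def
  proof (intro conjI allI impI)
    show "(\<lambda>_. 1 / (2*pi)) \<in> even_densities"
      using density[OF zero_bb] by (simp add: uniform)
    show "AE p in cylinder. stationarity_map \<beta> W D (\<lambda>_. 1 / (2*pi)) \<theta> p = 0" for \<theta>
    proof (rule AE_I2)
      fix p assume p: "p \<in> space cylinder"
      have "gibbs_map \<beta> W D (gibbs (\<lambda>_. 0)) \<theta> p = gibbs (\<lambda>_. 0) p"
        by (rule stationary[OF zero_bb p]) (simp only: uniform J_uniform mult_zero_right)
      then show "stationarity_map \<beta> W D (\<lambda>_. 1 / (2*pi)) \<theta> p = 0"
        by (simp add: stationarity_map_def uniform)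
    qed
    fix \<epsilon> :: real assume \<epsilon>: "\<epsilon> > 0"
    \<comment> \<open>The abstract theorem controls \<kappa>; continuity of the inverse at \<mu>
      turns this into control of \<theta> = 1 / \<kappa>.\<close>
    have "((\<lambda>\<kappa>. inverse \<kappa>) \<longlongrightarrow> inverse \<mu>) (at \<mu>)" using \<mu> by (intro tendsto_intros)
    then obtain d where d: "d > 0" "\<And>\<kappa>. \<bar>\<kappa> - \<mu>\<bar> < d \<Longrightarrow> \<bar>inverse \<kappa> - inverse \<mu>\<bar> < \<epsilon>"
      using \<epsilon> unfolding LIM_def dist_real_def by (metis abs_zero diff_self)
    \<comment> \<open>exp (2 r) - 1 will bound the L^1 distance to the uniform density when
      \<open>h\<close> is bounded by \<open>r\<close>.\<close>
    have "((\<lambda>r::real. exp (2 * r) - 1) \<longlongrightarrow> exp (2 * 0) - 1) (at_right 0)"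
      by (intro tendsto_diff tendsto_exp tendsto_mult tendsto_const tendsto_ident_at)
    then have "eventually (\<lambda>r::real. exp (2 * r) - 1 < \<epsilon>) (at_right 0)"
      using \<epsilon> by (intro order_tendstoD(2)) auto
    from eventually_happens'[OF trivial_limit_at_right_real eventually_conj[OF eventually_at_right_less this]]
    obtain r :: real where r: "r > 0" "exp (2 * r) - 1 < \<epsilon>" by blast
    \<comment> \<open>\<open>d\<close> is for the parameter, |\<mu>| keeps \<kappa> away from 0, and
      \<open>r\<close> bounds \<open>h\<close>.\<close>
    define e where "e = min (min d \<bar>\<mu>\<bar>) r"
    have e: "e > 0" using d r \<mu> by (simp add: e_def)
    obtain h \<kappa> where h: "h \<noteq> 0" "norm h < e" "\<bar>\<kappa> - \<mu>\<bar> < e" "\<kappa> *\<^sub>R h = T h + R h"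
      by (rule bifurcation_from_simple_eigenvalue[OF T_linear T_compact \<mu> T_\<phi> T_simple l_linear l_T l_\<phi>
          R_zero R_small e])
    have \<kappa>: "\<kappa> \<noteq> 0" using h(3) by (auto simp: e_def)
    have hb: "bounded_borel (apply_bcontfun h) r"
      using bounded_borel_mono[OF bounded_borel_bcontfun, of h r] h(2) by (simp add: e_def)
    let ?\<rho> = "gibbs (apply_bcontfun h)"
    obtain B where B: "bounded_borel (gibbs_remainder (apply_bcontfun h)) B"
      using gibbs_remainder_bounded_borel[OF hb] by blast
    \<comment> \<open>\<open>J_gibbs\<close> reassembles T h + R h into \<open>J\<close> of the
      density; its factor 2 pi cancels the one in \<open>c\<close>.\<close>
    have eq: "apply_bcontfun h p = - \<beta> * inverse \<kappa> * J ?\<rho> (cylinder_clamp p)" for p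
    proof -
      have "\<kappa> * apply_bcontfun h p = c * (J (apply_bcontfun h) (cylinder_clamp p)
          + J (gibbs_remainder (apply_bcontfun h)) (cylinder_clamp p))"
        using arg_cong[OF h(4), of "\<lambda>k. apply_bcontfun k p"]
        by (simp add: T_def R_def JC_apply[OF hb] JC_apply[OF B] distrib_left)
      also have "\<dots> = c * (2 * pi * J ?\<rho> (cylinder_clamp p))"
        by (subst J_gibbs[OF hb]) simp_all
      also have "\<dots> = - \<beta> * J ?\<rho> (cylinder_clamp p)" by (simp add: c_def)
      finally show ?thesis using \<kappa> by (simp add: field_simps)
    qed
    have fixed: "apply_bcontfun h (u, x) = - \<beta> * inverse \<kappa> * J ?\<rho> (u, x)" if "u \<in> {0..2*pi}" "x \<in> {0..1}" for u x
      using eq[of "(u, x)"] that by simp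
    have "?\<rho> \<in> even_densities"
    proof (rule density[OF hb])
      fix u x :: real assume "u \<in> {0..2*pi}" "x \<in> {0..1}"
      then show "apply_bcontfun h (2*pi - u, x) = apply_bcontfun h (u, x)"
        using fixed[of u x] fixed[of "2*pi - u" x] by (simp add: J_even)
    qed
    moreover have "(LINT p|cylinder. \<bar>?\<rho> p - 1 / (2*pi)\<bar>) < \<epsilon>"
    proof -
      have bound: "\<bar>?\<rho> p - 1 / (2*pi)\<bar> \<le> (exp (2 * r) - 1) / (2*pi)" for p
      proof -
        have "\<bar>2 * pi * ?\<rho> p - 1\<bar> \<le> exp (2 * r) - 1"
          by (rule abs_minus_one_le_exp[OF gibbs_bounds[OF hb]])
        moreover have "?\<rho> p - 1 / (2*pi) = (2 * pi * ?\<rho> p - 1) / (2*pi)" by (simp add: diff_divide_distrib)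
        ultimately show ?thesis by (simp only: abs_divide) (simp add: divide_right_mono)
      qed
      \<comment> \<open>The area 2 pi of the cylinder cancels the denominator.\<close>
      have "(LINT p|cylinder. \<bar>?\<rho> p - 1 / (2*pi)\<bar>) \<le> (LINT p|cylinder. (exp (2 * r) - 1) / (2*pi))"
        using bound r(1) by (intro integral_mono') auto
      also have "\<dots> = exp (2 * r) - 1"
      proof -
        have lborel_cylinder: "{0..2*pi} \<times> {0..1::real} \<in> sets lborel"
          by (simp add: borel_closed closed_Times)
        have "measure cylinder ({0..2*pi} \<times> {0..1}) = 2 * pi"
          using lborel_cylinder content_Pair[of "0::real" "0::real" "2*pi" 1]
            measure_completion[of "{0..2*pi} \<times> {0..1::real}" lborel]
          by (simp add: measure_restrict_space cbox_Pair_eq)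
        then show ?thesis by simp
      qed
      finally show ?thesis using r(2) by simp
    qed
    moreover have "\<bar>inverse \<kappa> - \<theta>\<^sub>0\<bar> < \<epsilon>"
      using d(2)[of \<kappa>] h(3) by (simp add: e_def \<mu>_def)
    moreover have "AE p in cylinder. stationarity_map \<beta> W D ?\<rho> (inverse \<kappa>) p = 0"
      using stationary[OF hb _ fixed] by (intro AE_I2) (simp add: stationarity_map_def)
    \<comment> \<open>\<open>J\<close> annihilates the uniform density, so a uniform solution would
      force h = 0 through \<open>eq\<close>.\<close>
    moreover have "\<not> (AE p in cylinder. ?\<rho> p = 1 / (2*pi))"
    proof
      assume "AE p in cylinder. ?\<rho> p = 1 / (2*pi)"
      from J_cong_AE[OF AE_cylinder_sections[OF this]] have J: "J ?\<rho> = J (\<lambda>_. 1 / (2*pi))" .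
      have "J (\<lambda>_. 1 / (2*pi)) (cylinder_clamp p) = 0" for p
        using J_constant[of "cylinder_clamp p" "\<lambda>_. 1 / (2*pi)"] by simp
      then have "h = 0" using eq unfolding J by (intro bcontfun_eqI) simp
      then show False using h(1) by contradiction
    qed
    ultimately show "\<exists>\<rho>\<in>even_densities. \<exists>\<theta>. (LINT p|cylinder. \<bar>\<rho> p - 1 / (2*pi)\<bar>) < \<epsilon> \<and> \<bar>\<theta> - \<theta>\<^sub>0\<bar> < \<epsilon> \<and>
        (AE p in cylinder. stationarity_map \<beta> W D \<rho> \<theta> p = 0) \<and> \<not> (AE p in cylinder. \<rho> p = 1 / (2*pi))"
      by blast
  qed
qed

end
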